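(* Let $\mathcal{F}$ be the class of planar graphs of maximum degree at most $4$, and let $G \in \mathcal{F}$ be a graph with $\chi_2(G) > 12$ that minimizes the pair $(|V(G)|, |E(G)|)$ (lexicographically) among all graphs of $\mathcal{F}$ with $\chi_2 > 12$, with a fixed planar embedding. Then $G$ does not contain any $4$-balanced separating cycle of length at most $5$.
   Context: All graphs are finite, without loops or parallel edges. A distance-$2$ coloring of a graph is an assignment of colors to its vertices such that any two distinct vertices at distance at most $2$ receive different colors; $\chi_2(G)$ is the minimum number of colors in a distance-$2$ coloring of $G$. In the fixed embedding, each cycle $C$ of $G$ splits the plane into its boundary, its inside and its outside. $C$ is a separating cycle if both its inside and its outside contain at least one vertex of $G$. A vertex of $C$ is unbalanced if all its neighbors in $V(G)\setminus V(C)$ lie on the same side of $C$ (all inside or all outside), and balanced otherwise. A separating cycle is $k$-balanced if at most $k$ of its vertices are balanced. *)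

theory Defs
  imports "HOL-Analysis.Analysis"
begin

definition simple_graph :: "'a set \<Rightarrow> ('a \<Rightarrow> 'a \<Rightarrow> bool) \<Rightarrow> bool" where
  "simple_graph V E \<longleftrightarrow> finite V \<and> (\<forall>u v. E u v \<longrightarrow> u \<in> V \<and> v \<in> V \<and> u \<noteq> v \<and> E v u)"

definition edge_set :: "'a set \<Rightarrow> ('a \<Rightarrow> 'a \<Rightarrow> bool) \<Rightarrow> 'a set set" where
  "edge_set V E = {{u, v} | u v. u \<in> V \<and> v \<in> V \<and> E u v}"

definition max_degree_le :: "'a set \<Rightarrow> ('a \<Rightarrow> 'a \<Rightarrow> bool) \<Rightarrow> nat \<Rightarrow> bool" where
  "max_degree_le V E d \<longleftrightarrow> (\<forall>v\<in>V. card {u\<in>V. E v u} \<le> d)"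

definition dist2_coloring :: "'a set \<Rightarrow> ('a \<Rightarrow> 'a \<Rightarrow> bool) \<Rightarrow> ('a \<Rightarrow> nat) \<Rightarrow> bool" where
  "dist2_coloring V E f \<longleftrightarrow>
     (\<forall>u\<in>V. \<forall>v\<in>V. u \<noteq> v \<and> (E u v \<or> (\<exists>w\<in>V. E u w \<and> E w v)) \<longrightarrow> f u \<noteq> f v)"

definition chi2 :: "'a set \<Rightarrow> ('a \<Rightarrow> 'a \<Rightarrow> bool) \<Rightarrow> nat" where
  "chi2 V E = (LEAST k. \<exists>f. dist2_coloring V E f \<and> card (f ` V) = k)"

definition plane_embedding ::
  "'a set \<Rightarrow> ('a \<Rightarrow> 'a \<Rightarrow> bool) \<Rightarrow> ('a \<Rightarrow> complex) \<Rightarrow> ('a \<Rightarrow> 'a \<Rightarrow> real \<Rightarrow> complex) \<Rightarrow> bool" where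
  "plane_embedding V E pos crv \<longleftrightarrow>
     inj_on pos V \<and>
     (\<forall>u v. E u v \<longrightarrow> arc (crv u v) \<and> pathstart (crv u v) = pos u \<and> pathfinish (crv u v) = pos v
        \<and> path_image (crv u v) = path_image (crv v u)
        \<and> path_image (crv u v) \<inter> pos ` V = {pos u, pos v}) \<and>
     (\<forall>u v x y. E u v \<and> E x y \<and> {u, v} \<noteq> {x, y} \<longrightarrow>
        path_image (crv u v) \<inter> path_image (crv x y) \<subseteq> pos ` ({u, v} \<inter> {x, y}))"

definition planar :: "'a set \<Rightarrow> ('a \<Rightarrow> 'a \<Rightarrow> bool) \<Rightarrow> bool" where
  "planar V E \<longleftrightarrow> (\<exists>(pos :: 'a \<Rightarrow> complex) crv. plane_embedding V E pos crv)"

definition in_F :: "'a set \<Rightarrow> ('a \<Rightarrow> 'a \<Rightarrow> bool) \<Rightarrow> bool" where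
  "in_F V E \<longleftrightarrow> simple_graph V E \<and> planar V E \<and> max_degree_le V E 4"

definition is_cycle :: "'a set \<Rightarrow> ('a \<Rightarrow> 'a \<Rightarrow> bool) \<Rightarrow> 'a list \<Rightarrow> bool" where
  "is_cycle V E C \<longleftrightarrow> length C \<ge> 3 \<and> distinct C \<and> set C \<subseteq> V \<and>
     (\<forall>i < length C. E (C ! i) (C ! ((i + 1) mod length C)))"

definition cycle_image :: "('a \<Rightarrow> 'a \<Rightarrow> real \<Rightarrow> complex) \<Rightarrow> 'a list \<Rightarrow> complex set" where
  "cycle_image crv C = (\<Union>i < length C. path_image (crv (C ! i) (C ! ((i + 1) mod length C))))"

definition inside_cycle :: "('a \<Rightarrow> complex) \<Rightarrow> ('a \<Rightarrow> 'a \<Rightarrow> real \<Rightarrow> complex) \<Rightarrow> 'a list \<Rightarrow> 'a \<Rightarrow> bool" where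
  "inside_cycle pos crv C v \<longleftrightarrow> pos v \<in> inside (cycle_image crv C)"

definition outside_cycle :: "('a \<Rightarrow> complex) \<Rightarrow> ('a \<Rightarrow> 'a \<Rightarrow> real \<Rightarrow> complex) \<Rightarrow> 'a list \<Rightarrow> 'a \<Rightarrow> bool" where
  "outside_cycle pos crv C v \<longleftrightarrow> pos v \<in> outside (cycle_image crv C)"

definition separating_cycle ::
  "'a set \<Rightarrow> ('a \<Rightarrow> 'a \<Rightarrow> bool) \<Rightarrow> ('a \<Rightarrow> complex) \<Rightarrow> ('a \<Rightarrow> 'a \<Rightarrow> real \<Rightarrow> complex) \<Rightarrow> 'a list \<Rightarrow> bool" where
  "separating_cycle V E pos crv C \<longleftrightarrow> is_cycle V E C \<and>
     (\<exists>v\<in>V - set C. inside_cycle pos crv C v) \<and> (\<exists>v\<in>V - set C. outside_cycle pos crv C v)"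

definition balanced_vertex ::
  "'a set \<Rightarrow> ('a \<Rightarrow> 'a \<Rightarrow> bool) \<Rightarrow> ('a \<Rightarrow> complex) \<Rightarrow> ('a \<Rightarrow> 'a \<Rightarrow> real \<Rightarrow> complex) \<Rightarrow> 'a list \<Rightarrow> 'a \<Rightarrow> bool" where
  "balanced_vertex V E pos crv C c \<longleftrightarrow> c \<in> set C \<and>
     \<not> ((\<forall>x\<in>V - set C. E c x \<longrightarrow> inside_cycle pos crv C x) \<or>
        (\<forall>x\<in>V - set C. E c x \<longrightarrow> outside_cycle pos crv C x))"

definition k_balanced ::
  "nat \<Rightarrow> 'a set \<Rightarrow> ('a \<Rightarrow> 'a \<Rightarrow> bool) \<Rightarrow> ('a \<Rightarrow> complex) \<Rightarrow> ('a \<Rightarrow> 'a \<Rightarrow> real \<Rightarrow> complex) \<Rightarrow> 'a list \<Rightarrow> bool" where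
  "k_balanced k V E pos crv C \<longleftrightarrow> separating_cycle V E pos crv C \<and>
     card {c \<in> set C. balanced_vertex V E pos crv C c} \<le> k"

end

theory Submission
  imports Defs
begin

text \<open>Color the closed inside and the closed outside of the cycle separately by minimality and
  permute the colors of the second coloring so that both agree on the cycle. A conflict can then
  only occur between the inner neighbor and the outer neighbor of a balanced vertex, and since at
  least 7 colors are not used on the cycle, a suitable permutation of them removes all conflicts,
  unless both neighbors of a balanced vertex repeat the color of the same cycle vertex \<open>c\<close>.
  An unbalanced \<open>c\<close> has no neighbor on one side and can be recolored last in the coloring of that
  side, so only pairs of balanced vertices that are not consecutive matter. Such a pair is separated
  by adding a chord, drawn through the other side, to one of the two smaller graphs. On a
  quadrangle, one diagonal is added to either graph. On a pentagon, some vertex is unbalanced; in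
  the graph of the side where it has no neighbor, the vertex is deleted and its two neighbors on the
  cycle are joined, which leaves a quadrangle and its two diagonals.\<close>

subsection \<open>Colorings\<close>

text \<open>The degree bound does the local work. Its two cycle neighbors leave a balanced vertex
  exactly one neighbor on each side, so there are at most 5 conflicts to avoid, no chord of the
  cycle ends at a balanced vertex, and discarding one side frees the degree needed for a new chord.
  The length bound puts any two cycle vertices within distance 2, so both colorings are injective on
  the cycle and a permutation can match them. The obstacle is planarity. Two crossing diagonals
  cannot be drawn through the same side, so the two smaller graphs take one each. A pentagon has
  five diagonals and a side has room for only two of them, so this method cannot treat five balanced
  vertices. With an unbalanced vertex at most three critical pairs remain, and the edge that
  replaces the deleted vertex settles one of them.\<close>

lemma dist2_coloring_if_chi2_le:
  assumes "finite W" and "chi2 W F \<le> n"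
  shows "\<exists>f. dist2_coloring W F f \<and> f ` W \<subseteq> {..<n}"
proof -
  let ?P = "\<lambda>k. \<exists>f. dist2_coloring W F f \<and> card (f ` W) = k"
  \<comment> \<open>An injective coloring makes the set under \<open>LEAST\<close> in
    \<open>chi2\<close> nonempty, so the minimum is attained.\<close>
  obtain i :: "'a \<Rightarrow> nat" where i: "inj_on i W"
    using finite_imp_inj_to_nat_seg[OF \<open>finite W\<close>] by metis
  have "dist2_coloring W F i"
    using i unfolding dist2_coloring_def by (meson inj_onD)
  then have "?P (card (i ` W))" by blast
  then have "?P (chi2 W F)"
    unfolding chi2_def by (rule LeastI)
  then obtain f where f: "dist2_coloring W F f" "card (f ` W) \<le> n"
    using assms by auto
  obtain r :: "nat \<Rightarrow> nat" where r: "inj_on r (f ` W)" "r ` (f ` W) \<subseteq> {..<n}"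
    using card_le_inj[of "f ` W" "{..<n}"] f assms by auto
  have "dist2_coloring W F (r \<circ> f)"
    using f(1) r(1) unfolding dist2_coloring_def inj_on_def by (metis comp_apply imageI)
  moreover have "(r \<circ> f) ` W \<subseteq> {..<n}"
    using r(2) unfolding image_comp[symmetric] .
  ultimately show ?thesis by blast
qed

lemma chi2_le_if_dist2_coloring:
  assumes "dist2_coloring W F f" and "f ` W \<subseteq> {..<n}"
  shows "chi2 W F \<le> n"
proof -
  have "chi2 W F \<le> card (f ` W)"
    unfolding chi2_def using assms by (intro Least_le) blast
  also have "\<dots> \<le> n" using card_mono[OF _ assms(2)] by simp
  finally show ?thesis .
qed

text \<open>Of the \<open>m\<close> cyclic shifts of an enumeration, each forbidden pair rules out only one.\<close>

lemma bij_betw_avoiding: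
  assumes "finite A" "finite B" "card A = card B" "finite P" "card P < card A"
  shows "\<exists>h. bij_betw h A B \<and> (\<forall>a\<in>A. (a, h a) \<notin> P)"
proof -
  define m where "m = card A"
  have m: "m > 0" using assms m_def by simp
  obtain e where e: "bij_betw e A {..<m}"
    using ex_bij_betw_finite_nat[OF assms(1)] m_def by (metis atLeast0LessThan)
  obtain d where d: "bij_betw d {..<m} B"
    using ex_bij_betw_nat_finite[OF assms(2)] m_def assms(3) by (metis atLeast0LessThan)
  \<comment> \<open>For \<open>x\<close> in \<open>A\<close> and \<open>y\<close> in
    \<open>B\<close>, this is the only shift that sends \<open>x\<close> to \<open>y\<close>; adding
    \<open>m - e x\<close> instead of subtracting \<open>e x\<close> avoids truncated
    subtraction.\<close>
  define k where "k = (\<lambda>(x, y). (inv_into {..<m} d y + (m - e x)) mod m)"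
  have "card (k ` P) < card {..<m}"
    using card_image_le[OF assms(4), of k] assms(5) m_def by simp
  then have "\<not> {..<m} \<subseteq> k ` P"
    using card_mono[OF finite_imageI[OF assms(4)], of "{..<m}" k] by linarith
  then obtain t where t: "t < m" "t \<notin> k ` P" by auto
  have shift: "bij_betw (\<lambda>i. (i + t) mod m) {..<m} {..<m}"
  proof -
    have "inj_on (\<lambda>i. (i + t) mod m) {..<m}"
    proof (rule inj_onI)
      fix i j assume "i \<in> {..<m}" "j \<in> {..<m}" "(i + t) mod m = (j + t) mod m"
      then show "i = j"
        using t(1) by (auto simp: mod_if split: if_splits)
    qed
    moreover have "(\<lambda>i. (i + t) mod m) ` {..<m} \<subseteq> {..<m}" using m by auto
    ultimately show ?thesis
      by (simp add: bij_betw_def endo_inj_surj)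
  qed
  define h where "h = d \<circ> (\<lambda>i. (i + t) mod m) \<circ> e"
  have "bij_betw h A B"
    unfolding h_def using bij_betw_trans[OF e bij_betw_trans[OF shift d]] by (simp add: comp_assoc)
  moreover have "(a, h a) \<notin> P" if "a \<in> A" for a
  proof
    assume P: "(a, h a) \<in> P"
    have ea: "e a < m" using e that by (auto simp: bij_betw_def)
    have "inv_into {..<m} d (h a) = (e a + t) mod m"
      unfolding h_def using d m by (simp add: bij_betw_def)
    then have "k (a, h a) = ((e a + t) mod m + (m - e a)) mod m"
      by (simp add: k_def)
    also have "\<dots> = (e a + t + (m - e a)) mod m" by (simp add: mod_add_left_eq)
    also have "\<dots> = t" using ea t(1) by simp
    finally show False using P t(2) by (metis imageI)
  qed
  ultimately show ?thesis by blast
qed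

subsection \<open>Adding an arc to a plane graph\<close>

definition add_edge :: "('a \<Rightarrow> 'a \<Rightarrow> bool) \<Rightarrow> 'a \<Rightarrow> 'a \<Rightarrow> 'a \<Rightarrow> 'a \<Rightarrow> bool" where
  "add_edge F a b u v \<longleftrightarrow> F u v \<or> u = a \<and> v = b \<or> u = b \<and> v = a"

text \<open>\<open>plane_embedding\<close> wants a curve for each orientation of an edge, hence the
  reversed copy. A curve that already joins \<open>a\<close> and \<open>b\<close> is
  overwritten.\<close>

definition add_arc ::
  "('a \<Rightarrow> 'a \<Rightarrow> real \<Rightarrow> complex) \<Rightarrow> 'a \<Rightarrow> 'a \<Rightarrow> (real \<Rightarrow> complex) \<Rightarrow> 'a \<Rightarrow> 'a \<Rightarrow> real \<Rightarrow> complex" where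
  "add_arc crv a b \<gamma> u v =
     (if u = a \<and> v = b then \<gamma> else if u = b \<and> v = a then reversepath \<gamma> else crv u v)"

lemma simple_graph_add_edge:
  assumes "simple_graph W F" "a \<in> W" "b \<in> W" "a \<noteq> b"
  shows "simple_graph W (add_edge F a b)"
  using assms unfolding simple_graph_def add_edge_def by metis

lemma card_nbrs_add_edge:
  assumes "finite W"
  shows "card {u\<in>W. add_edge F a b v u} \<le> card {u\<in>W. F v u} + (if v = a \<or> v = b then 1 else 0)"
proof (cases "v = a \<or> v = b")
  case True
  then obtain w where "{u\<in>W. add_edge F a b v u} \<subseteq> insert w {u\<in>W. F v u}"
    unfolding add_edge_def by (cases "v = a") fastforce+
  then have "card {u\<in>W. add_edge F a b v u} \<le> card (insert w {u\<in>W. F v u})"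
    using assms by (intro card_mono) auto
  also have "\<dots> \<le> card {u\<in>W. F v u} + 1" by (simp add: card_insert_le_m1 card_insert_if assms)
  finally show ?thesis using True by simp
qed (simp add: add_edge_def)

lemma path_image_add_arc:
  "{u, v} = {a, b} \<Longrightarrow> path_image (add_arc crv a b \<gamma> u v) = path_image \<gamma>"
  "{u, v} \<noteq> {a, b} \<Longrightarrow> add_arc crv a b \<gamma> u v = crv u v"
proof -
  assume "{u, v} = {a, b}"
  then consider "u = a" "v = b" | "u = b" "v = a" unfolding doubleton_eq_iff by blast
  then show "path_image (add_arc crv a b \<gamma> u v) = path_image \<gamma>"
    by cases (simp_all add: add_arc_def)
next
  assume "{u, v} \<noteq> {a, b}"
  then have "\<not> (u = a \<and> v = b)" "\<not> (u = b \<and> v = a)" by blast+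
  then show "add_arc crv a b \<gamma> u v = crv u v"
    unfolding add_arc_def by (simp only: if_False)
qed

lemma plane_embeddingD:
  assumes "plane_embedding W F pos crv"
  shows "inj_on pos W"
    and "F u v \<Longrightarrow> arc (crv u v)"
    and "F u v \<Longrightarrow> pathstart (crv u v) = pos u"
    and "F u v \<Longrightarrow> pathfinish (crv u v) = pos v"
    and "F u v \<Longrightarrow> path_image (crv u v) = path_image (crv v u)"
    and "F u v \<Longrightarrow> path_image (crv u v) \<inter> pos ` W = {pos u, pos v}"
    and "F u v \<Longrightarrow> F x y \<Longrightarrow> {u, v} \<noteq> {x, y} \<Longrightarrow>
      path_image (crv u v) \<inter> path_image (crv x y) \<subseteq> pos ` ({u, v} \<inter> {x, y})"
proof -
  note emb = assms[unfolded plane_embedding_def]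
  show "inj_on pos W" by (rule emb[THEN conjunct1])
  assume uv: "F u v"
  note edge = emb[THEN conjunct2, THEN conjunct1, rule_format, OF uv]
  show "arc (crv u v)" "pathstart (crv u v) = pos u" "pathfinish (crv u v) = pos v"
    "path_image (crv u v) = path_image (crv v u)"
    "path_image (crv u v) \<inter> pos ` W = {pos u, pos v}"
    using edge by argo+
  assume "F x y" "{u, v} \<noteq> {x, y}"
  then show "path_image (crv u v) \<inter> path_image (crv x y) \<subseteq> pos ` ({u, v} \<inter> {x, y})"
    by (intro emb[THEN conjunct2, THEN conjunct2, rule_format]) (simp add: uv)
qed

lemma plane_embedding_mono:
  assumes emb: "plane_embedding V E pos crv" and "W \<subseteq> V"
    and F: "\<And>u v. F u v \<Longrightarrow> E u v \<and> u \<in> W \<and> v \<in> W"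
  shows "plane_embedding W F pos crv"
  unfolding plane_embedding_def
proof (intro conjI allI impI)
  show "inj_on pos W" using plane_embeddingD(1)[OF emb] \<open>W \<subseteq> V\<close> inj_on_subset by blast
  fix u v assume uv: "F u v"
  note D = plane_embeddingD(2-6)[OF emb, of u v]
  show "arc (crv u v)" "pathstart (crv u v) = pos u" "pathfinish (crv u v) = pos v"
    "path_image (crv u v) = path_image (crv v u)"
    using D(1-4) F[OF uv] by blast+
  show "path_image (crv u v) \<inter> pos ` W = {pos u, pos v}"
    using D(5) F[OF uv] \<open>W \<subseteq> V\<close> by blast
next
  fix u v x y assume "F u v \<and> F x y \<and> {u, v} \<noteq> {x, y}"
  then show "path_image (crv u v) \<inter> path_image (crv x y) \<subseteq> pos ` ({u, v} \<inter> {x, y})"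
    using plane_embeddingD(7)[OF emb, of u v x y] F by blast
qed

lemma plane_embedding_add_edge:
  assumes gr: "simple_graph W F" and emb: "plane_embedding W F pos crv"
    and ab: "a \<in> W" "b \<in> W" "a \<noteq> b"
    and \<gamma>: "arc \<gamma>" "pathstart \<gamma> = pos a" "pathfinish \<gamma> = pos b"
    and \<gamma>W: "path_image \<gamma> \<inter> pos ` W \<subseteq> {pos a, pos b}"
    and \<gamma>F: "\<And>u v. F u v \<Longrightarrow> path_image \<gamma> \<inter> path_image (crv u v) \<subseteq> {pos a, pos b}"
  shows "plane_embedding W (add_edge F a b) pos (add_arc crv a b \<gamma>)"
proof -
  let ?F = "add_edge F a b" and ?c = "add_arc crv a b \<gamma>"
  have inj: "inj_on pos W" using emb unfolding plane_embedding_def by blast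
  have \<gamma>W': "path_image \<gamma> \<inter> pos ` W = {pos a, pos b}"
    using \<gamma>W ab \<gamma> pathstart_in_path_image[of \<gamma>] pathfinish_in_path_image[of \<gamma>] by auto
  have cF: "path_image (crv u v) \<inter> pos ` W = {pos u, pos v}" if "F u v" for u v
    using emb that unfolding plane_embedding_def by blast
  \<comment> \<open>\<open>\<gamma>F\<close> allows contact at either end of
    \<open>\<gamma>\<close>. The curve of \<open>u v\<close> passes through no vertices except
    \<open>u\<close> and \<open>v\<close>, so such a contact is at a common end of both
    edges.\<close>
  have new: "path_image \<gamma> \<inter> path_image (crv u v) \<subseteq> pos ` ({a, b} \<inter> {u, v})"
    if uv: "F u v" for u v
  proof
    fix p assume p: "p \<in> path_image \<gamma> \<inter> path_image (crv u v)"
    then obtain e where e: "p = pos e" "e \<in> {a, b}" using \<gamma>F[OF uv] by blast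
    then have "pos e \<in> {pos u, pos v}" using p cF[OF uv] ab by blast
    moreover have "u \<in> W" "v \<in> W" using gr uv unfolding simple_graph_def by blast+
    ultimately have "e \<in> {u, v}" using inj e(2) ab by (auto dest: inj_onD)
    then show "p \<in> pos ` ({a, b} \<inter> {u, v})" using e by blast
  qed
  show ?thesis
    unfolding plane_embedding_def
  proof (intro conjI allI impI)
    show "inj_on pos W" by (rule inj)
    fix u v assume uv: "?F u v"
    consider "u = a" "v = b" | "u = b" "v = a" | "{u, v} \<noteq> {a, b}" "F u v"
      using uv unfolding add_edge_def by (auto simp: doubleton_eq_iff)
    then have "arc (?c u v) \<and> pathstart (?c u v) = pos u \<and> pathfinish (?c u v) = pos v \<and>
      path_image (?c u v) = path_image (?c v u) \<and> path_image (?c u v) \<inter> pos ` W = {pos u, pos v}"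
    proof cases
      case 1
      then show ?thesis using \<gamma> \<gamma>W' ab by (simp add: add_arc_def)
    next
      case 2
      then show ?thesis using \<gamma> \<gamma>W' ab by (simp add: add_arc_def arc_reversepath insert_commute)
    next
      case 3
      moreover have "{v, u} \<noteq> {a, b}" using 3 by blast
      ultimately show ?thesis
        using plane_embeddingD(2-6)[OF emb, of u v] path_image_add_arc(2) by metis
    qed
    then show "arc (?c u v)" "pathstart (?c u v) = pos u" "pathfinish (?c u v) = pos v"
      "path_image (?c u v) = path_image (?c v u)"
      "path_image (?c u v) \<inter> pos ` W = {pos u, pos v}" by blast+
  next
    fix u v x y assume *: "?F u v \<and> ?F x y \<and> {u, v} \<noteq> {x, y}"
    have F: "F s t" if "?F s t" "{s, t} \<noteq> {a, b}" for s t
      using that unfolding add_edge_def by auto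
    consider "{u, v} = {a, b}" "{x, y} \<noteq> {a, b}" | "{u, v} \<noteq> {a, b}" "{x, y} = {a, b}"
      | "{u, v} \<noteq> {a, b}" "{x, y} \<noteq> {a, b}" using * by metis
    then show "path_image (?c u v) \<inter> path_image (?c x y) \<subseteq> pos ` ({u, v} \<inter> {x, y})"
    proof cases
      case 1
      then show ?thesis using new[OF F, of x y] * by (simp add: path_image_add_arc)
    next
      case 2
      then show ?thesis using new[OF F, of u v] * by (simp add: path_image_add_arc Int_commute)
    next
      case 3
      then show ?thesis using plane_embeddingD(7)[OF emb F F, of u v x y] *
        by (simp add: path_image_add_arc)
    qed
  qed
qed

text \<open>An edge that starts inside a side may end on the cycle; only the curve without its end
  point, the image of \<open>[0, 1)\<close>, can be confined to that side.\<close>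

lemma connected_arc_diff_pathfinish:
  assumes "arc g"
  shows "connected (path_image g - {pathfinish g})"
proof -
  have inj: "inj_on g {0..1}" using assms unfolding arc_def by simp
  have "{0..<1} = {0..1} - {1::real}" by auto
  then have "g ` {0..<1} = path_image g - {pathfinish g}"
    using inj_on_image_set_diff[OF inj, of "{0..1}" "{1}"]
    unfolding path_image_def pathfinish_def by simp
  moreover have "continuous_on {0..<1} g"
    using assms unfolding arc_def path_def by (auto intro: continuous_on_subset)
  ultimately show ?thesis by (metis connected_Ico connected_continuous_image)
qed

subsection \<open>Cycles with two symmetric sides\<close>

text \<open>With \<open>S\<close> one of the two sides of the cycle \<open>C\<close>: a cycle vertex
  is unbalanced iff it is lone for at least one side.\<close>

definition lone :: "('a \<Rightarrow> 'a \<Rightarrow> bool) \<Rightarrow> 'a set \<Rightarrow> 'a set \<Rightarrow> 'a set" where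
  "lone E C S = {c \<in> C. \<forall>x\<in>S. \<not> E c x}"

text \<open>The vertices of \<open>D\<close> are ignored: they are to be colored later. Colors of distinct cycle
  vertices differ even when their distance is larger than 2.\<close>

definition side_coloring ::
  "'a set \<Rightarrow> ('a \<Rightarrow> 'a \<Rightarrow> bool) \<Rightarrow> 'a set \<Rightarrow> 'a set \<Rightarrow> 'a set \<Rightarrow> ('a \<Rightarrow> nat) \<Rightarrow> bool" where
  "side_coloring V E C S D f \<longleftrightarrow>
     (\<forall>u\<in>C \<union> S - D. f u < 12) \<and>
     (\<forall>u\<in>C \<union> S - D. \<forall>v\<in>C \<union> S - D.
        u \<noteq> v \<and> (E u v \<or> (\<exists>w\<in>V. E u w \<and> E w v) \<or> u \<in> C \<and> v \<in> C) \<longrightarrow> f u \<noteq> f v)"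

text \<open>This is what an edge \<open>a b\<close> in the smaller graph buys: the neighbors of
  \<open>a\<close> come within distance 2 of \<open>b\<close>, and conversely. Having it on one of
  the two sides is enough for the pair.\<close>

definition repels ::
  "('a \<Rightarrow> 'a \<Rightarrow> bool) \<Rightarrow> 'a set \<Rightarrow> ('a \<Rightarrow> nat) \<Rightarrow> 'a \<Rightarrow> 'a \<Rightarrow> bool" where
  "repels E S f a b \<longleftrightarrow> (\<forall>x\<in>S. (E a x \<longrightarrow> f x \<noteq> f b) \<and> (E b x \<longrightarrow> f x \<noteq> f a))"

text \<open>\<open>A\<close> and \<open>B\<close> are the inside and the outside of the curve \<open>J\<close>, in either order; this symmetry
  is exploited throughout through the interpretation \<open>sw\<close>.\<close>

locale plane_cycle =
  fixes V :: "'a set" and E :: "'a \<Rightarrow> 'a \<Rightarrow> bool"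
    and pos :: "'a \<Rightarrow> complex" and crv :: "'a \<Rightarrow> 'a \<Rightarrow> real \<Rightarrow> complex"
    and cyc :: "'a \<Rightarrow> 'a \<Rightarrow> bool" and C :: "'a set" and J :: "complex set"
    and A B :: "complex set" and S T :: "'a set"
  assumes graph: "simple_graph V E"
    and max_deg: "max_degree_le V E 4"
    and emb: "plane_embedding V E pos crv"
    and smaller: "\<And>(W :: 'a set) F. in_F W F \<Longrightarrow> card W < card V \<Longrightarrow> chi2 W F \<le> 12"
    and A: "open A" "connected A" and B: "open B" "connected B"
    and regions: "A \<inter> B = {}" "A \<union> B = - J"
    and S_def: "S = {v \<in> V. pos v \<in> A}" and T_def: "T = {v \<in> V. pos v \<in> B}"
    and nonempty: "S \<noteq> {}" "T \<noteq> {}"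
    and C_sub: "C \<subseteq> V" and C_card: "card C \<le> 5"
    and cyc_sym: "cyc u v \<Longrightarrow> cyc v u"
    and cyc_edge: "cyc u v \<Longrightarrow> E u v \<and> u \<in> C \<and> v \<in> C"
    and J_eq: "J = \<Union>{path_image (crv u v) |u v. cyc u v}"
    and cyc_deg: "c \<in> C \<Longrightarrow> card {u. cyc c u} = 2"
    and cyc_diam: "u \<in> C \<Longrightarrow> v \<in> C \<Longrightarrow> u \<noteq> v \<Longrightarrow> cyc u v \<or> (\<exists>w. cyc u w \<and> cyc w v)"
begin

abbreviation "lone_S \<equiv> lone E C S"
abbreviation "lone_T \<equiv> lone E C T"
abbreviation "bal \<equiv> C - lone_S - lone_T"

lemma swap: "plane_cycle V E pos crv cyc C J B A T S"
proof
  show "cyc u v \<Longrightarrow> cyc v u" for u v by (rule cyc_sym)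
  show "c \<in> C \<Longrightarrow> card {u. cyc c u} = 2" for c by (rule cyc_deg)
  show "u \<in> C \<Longrightarrow> v \<in> C \<Longrightarrow> u \<noteq> v \<Longrightarrow> cyc u v \<or> (\<exists>w. cyc u w \<and> cyc w v)" for u v
    by (rule cyc_diam)
  show "\<And>(W :: 'a set) F. in_F W F \<Longrightarrow> card W < card V \<Longrightarrow> chi2 W F \<le> 12" by (rule smaller)
  show "B \<union> A = - J" using regions(2) by (simp only: Un_commute)
  show "J = \<Union>{path_image (crv u v) |u v. cyc u v}" by (rule J_eq)
qed (use graph max_deg emb A B regions(1) S_def T_def nonempty C_sub C_card cyc_edge in auto)

section \<open>Basic facts and the separation of the two sides\<close>

lemma finite_V: "finite V" and E_sym: "E u v \<Longrightarrow> E v u" and E_V: "E u v \<Longrightarrow> u \<in> V \<and> v \<in> V"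
  and E_irrefl: "\<not> E u u"
  using graph unfolding simple_graph_def by blast+

lemma finite_nbrs: "finite {v. E u v}"
  using finite_V by (rule rev_finite_subset) (use E_V in blast)

lemma card_nbrs: "card {v. E u v} \<le> 4"
proof (cases "u \<in> V")
  case True
  moreover have "{v. E u v} = {v\<in>V. E u v}" using E_V by blast
  ultimately show ?thesis using max_deg unfolding max_degree_le_def by simp
next
  case False
  then have "{v. E u v} = {}" using E_V by blast
  then show ?thesis by simp
qed

lemma finite_C: "finite C" using C_sub finite_V finite_subset by blast

lemma ex_cyc: "c \<in> C \<Longrightarrow> \<exists>u. cyc c u"
  using cyc_deg[of c] by (metis card.empty empty_Collect_eq zero_neq_numeral)

lemma pos_in_J: "v \<in> V \<Longrightarrow> pos v \<in> J \<longleftrightarrow> v \<in> C"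
proof
  assume v: "v \<in> V" "pos v \<in> J"
  then obtain s t where st: "cyc s t" "pos v \<in> path_image (crv s t)" unfolding J_eq by blast
  then have "pos v \<in> {pos s, pos t}"
    using plane_embeddingD(6)[OF emb, of s t] cyc_edge v by blast
  then have "v = s \<or> v = t"
    using plane_embeddingD(1)[OF emb] cyc_edge[OF st(1)] E_V v by (auto dest: inj_onD)
  then show "v \<in> C" using cyc_edge[OF st(1)] by blast
next
  assume "v \<in> V" "v \<in> C"
  then obtain t where "cyc v t" using ex_cyc by blast
  moreover from this have "pos v \<in> path_image (crv v t)"
    using plane_embeddingD(6)[OF emb, of v t] cyc_edge by blast
  ultimately show "pos v \<in> J" unfolding J_eq by blast
qed

lemma V_cases: "v \<in> V \<longleftrightarrow> v \<in> C \<or> v \<in> S \<or> v \<in> T"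
  using pos_in_J[of v] regions C_sub unfolding S_def T_def by blast

lemma disjoint: "v \<in> C \<Longrightarrow> v \<notin> S" "v \<in> C \<Longrightarrow> v \<notin> T" "v \<in> S \<Longrightarrow> v \<notin> T"
  using pos_in_J[of v] regions C_sub unfolding S_def T_def by blast+

lemma connected_in_A:
  assumes "connected X" "X \<inter> J = {}" "X \<inter> A \<noteq> {}"
  shows "X \<subseteq> A"
proof (rule ccontr)
  assume "\<not> X \<subseteq> A"
  then have "X \<inter> B \<noteq> {}" using assms(2) regions(2) by blast
  moreover have "X \<subseteq> A \<union> B" "A \<inter> B \<inter> X = {}" using assms(2) regions by blast+
  ultimately show False using assms(1,3) A(1) B(1) unfolding connected_def by blast
qed

lemma edge_J:
  assumes "E u v" "\<not> cyc u v"
  shows "path_image (crv u v) \<inter> J \<subseteq> pos ` ({u, v} \<inter> C)"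
proof
  fix p assume p: "p \<in> path_image (crv u v) \<inter> J"
  then obtain s t where st: "cyc s t" "p \<in> path_image (crv s t)" unfolding J_eq by blast
  have "{u, v} \<noteq> {s, t}" using assms(2) st(1) cyc_sym by (metis doubleton_eq_iff)
  then have "p \<in> pos ` ({u, v} \<inter> {s, t})"
    using plane_embeddingD(7)[OF emb, of u v s t] assms(1) cyc_edge st p by blast
  then show "p \<in> pos ` ({u, v} \<inter> C)" using cyc_edge[OF st(1)] by blast
qed

text \<open>Since \<open>u\<close> is off the cycle, the curve can meet \<open>J\<close> at most at
  its end \<open>pos v\<close>; up to there it is connected and misses \<open>J\<close>, so it
  cannot leave \<open>A\<close>.\<close>

lemma edge_from_S:
  assumes "E u v" "u \<in> S"
  shows "path_image (crv u v) - {pos v} \<subseteq> A" and "v \<notin> T"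
proof -
  have ncyc: "\<not> cyc u v" using assms cyc_edge disjoint by blast
  note D = plane_embeddingD(2-6)[OF emb assms(1)]
  have arc: "connected (path_image (crv u v) - {pos v})"
    using connected_arc_diff_pathfinish[OF D(1)] D(3) by simp
  have uC: "u \<notin> C" using disjoint assms by blast
  have "pos u \<noteq> pos v"
    using plane_embeddingD(1)[OF emb] E_V[OF assms(1)] E_irrefl assms(1) by (metis inj_onD)
  then have uA: "pos u \<in> (path_image (crv u v) - {pos v}) \<inter> A"
    using D(5) assms(2) unfolding S_def by blast
  have "path_image (crv u v) \<inter> J \<subseteq> {pos v}"
    using edge_J[OF assms(1) ncyc] uC by blast
  then show "path_image (crv u v) - {pos v} \<subseteq> A"
    using connected_in_A[OF arc] uA by blast
  show "v \<notin> T"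
  proof
    assume vT: "v \<in> T"
    then have "v \<notin> C" using disjoint by blast
    then have "path_image (crv u v) \<inter> J = {}" using edge_J[OF assms(1) ncyc] uC by blast
    moreover have "connected (path_image (crv u v))"
      using D(1) by (intro connected_path_image arc_imp_path)
    ultimately have "path_image (crv u v) \<subseteq> A" using connected_in_A uA by blast
    moreover have "pos v \<in> path_image (crv u v) \<inter> B" using D(5) vT unfolding T_def by blast
    ultimately show False using regions by blast
  qed
qed

lemma not_E_ST: "x \<in> S \<Longrightarrow> y \<in> T \<Longrightarrow> \<not> E x y" "x \<in> S \<Longrightarrow> y \<in> T \<Longrightarrow> \<not> E y x"
  using edge_from_S E_sym by blast+

section \<open>Degrees at the cycle and the recoloring of lone vertices\<close>

text \<open>Two rim neighbors and at least one neighbor on each side already exhaust the degree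
  4.\<close>

lemma bal_nbrs:
  assumes "c \<in> bal"
  obtains x y where "x \<in> S" "y \<in> T" "E c x" "E c y" "{v. E c v} = {v. cyc c v} \<union> {x, y}"
proof -
  from assms obtain x y where xy: "x \<in> S" "y \<in> T" "E c x" "E c y" unfolding lone_def by blast
  have sub: "{v. cyc c v} \<union> {x, y} \<subseteq> {v. E c v}" using cyc_edge xy by blast
  have "card ({v. cyc c v} \<union> {x, y}) = card {v. cyc c v} + card {x, y}"
  proof (rule card_Un_disjoint)
    show "finite {v. cyc c v}" using finite_nbrs[of c] sub finite_subset by blast
    show "{v. cyc c v} \<inter> {x, y} = {}" using xy cyc_edge disjoint by blast
  qed simp
  moreover have "x \<noteq> y" using xy disjoint by blast
  ultimately have "card ({v. cyc c v} \<union> {x, y}) = 4" using cyc_deg assms by simp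
  then have "{v. cyc c v} \<union> {x, y} = {v. E c v}"
    using card_seteq[OF finite_nbrs sub] card_nbrs[of c] by simp
  then show ?thesis using that xy by metis
qed

lemma bal_edge_cyc: "c \<in> bal \<Longrightarrow> E c v \<Longrightarrow> v \<in> C \<Longrightarrow> cyc c v"
  using disjoint by (elim bal_nbrs) blast

lemma card_nbrs_S_bal: "c \<in> bal \<Longrightarrow> card {x\<in>S. E c x} \<le> 1"
proof (elim bal_nbrs)
  fix x y assume "x \<in> S" "y \<in> T" "E c x" "E c y" "{v. E c v} = {v. cyc c v} \<union> {x, y}"
  then have "{x\<in>S. E c x} \<subseteq> {x}" using cyc_edge disjoint by blast
  then show ?thesis using card_mono[of "{x}"] by simp
qed

text \<open>The two rim neighbors take up two of the four places at \<open>c\<close>, and a chord of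
  the cycle ending at \<open>c\<close> takes a third.\<close>

lemma card_nbrs_S:
  assumes "c \<in> C"
  shows "card {x\<in>S. E c x} \<le> 2" and "E c b \<Longrightarrow> b \<in> C \<Longrightarrow> \<not> cyc c b \<Longrightarrow> card {x\<in>S. E c x} \<le> 1"
proof -
  have *: "card {x\<in>S. E c x} + card X \<le> 4" if "X \<subseteq> {v. E c v}" "X \<subseteq> C" for X
  proof -
    have "card {x\<in>S. E c x} + card X = card ({x\<in>S. E c x} \<union> X)"
    proof (rule card_Un_disjoint[symmetric])
      show "finite {x\<in>S. E c x}" using finite_nbrs[of c] by (rule rev_finite_subset) blast
      show "finite X" using finite_C that finite_subset by blast
      show "{x\<in>S. E c x} \<inter> X = {}" using disjoint that by blast
    qed
    also have "\<dots> \<le> card {v. E c v}" using that finite_nbrs by (intro card_mono) auto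
    finally show ?thesis using card_nbrs[of c] by simp
  qed
  have cyc: "{v. cyc c v} \<subseteq> {v. E c v}" "{v. cyc c v} \<subseteq> C" using cyc_edge by blast+
  then show "card {x\<in>S. E c x} \<le> 2" using *[of "{v. cyc c v}"] cyc_deg[OF assms] by simp
  assume b: "E c b" "b \<in> C" "\<not> cyc c b"
  have "finite {v. cyc c v}" using finite_subset[OF cyc(2) finite_C] .
  then have "card (insert b {v. cyc c v}) = 3" using b cyc_deg[OF assms] by simp
  then show "card {x\<in>S. E c x} \<le> 1" using *[of "insert b {v. cyc c v}"] b cyc by simp
qed

text \<open>For \<open>m\<close> cycle vertices, at most \<open>(m - 1) + ((m - 1) + 2) \<le> 10\<close> colors are forbidden at \<open>c\<close>.\<close>

lemma insert_lone:
  assumes f: "side_coloring V E C S (insert c D) f" and c: "c \<in> lone_S"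
  obtains k where "side_coloring V E C S D (f(c := k))"
    "\<And>b x. b \<in> bal \<Longrightarrow> x \<in> S \<Longrightarrow> E b x \<Longrightarrow> f x \<noteq> k"
proof -
  have cC: "c \<in> C" and c_lone: "\<And>x. x \<in> S \<Longrightarrow> \<not> E c x" using c unfolding lone_def by blast+
  \<comment> \<open>Behind \<open>b\<close>, two kinds of colors are to be avoided: those at
    distance 2 from \<open>c\<close> through \<open>b\<close>, and those next to a balanced
    \<open>b\<close>, which must not repeat the color of \<open>c\<close> when the two sides are
    glued.\<close>
  define M where "M b = {x\<in>S. E b x \<and> (b \<in> bal \<or> E c b)}" for b
  define X where "X = (C - {c}) \<union> (\<Union>b\<in>C - {c}. M b)"
  have finM: "finite (M b)" for b
    using finite_nbrs[of b] by (rule rev_finite_subset) (auto simp: M_def)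
  \<comment> \<open>Only the two rim neighbors of \<open>c\<close> can contribute two vertices: a
    balanced \<open>b\<close> has one neighbor in \<open>S\<close>, and a chord from
    \<open>c\<close> to \<open>b\<close> takes up a place at \<open>b\<close>. This is the source of
    the summand 2.\<close>
  have M: "card (M b) \<le> (if cyc c b then 2 else 1)" if b: "b \<in> C - {c}" for b
  proof -
    have sub: "card (M b) \<le> card {x\<in>S. E b x}"
      using finite_nbrs[of b] by (intro card_mono) (auto simp: M_def intro: rev_finite_subset)
    consider "cyc c b" | "b \<in> bal" | "E c b" "\<not> cyc c b" | "\<not> E c b" "b \<notin> bal" by blast
    then show ?thesis
    proof cases
      case 1
      then show ?thesis using sub card_nbrs_S(1)[of b] b by simp
    next
      case 2
      then show ?thesis using sub card_nbrs_S_bal[of b] by simp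
    next
      case 3
      then have "E b c" "\<not> cyc b c" using E_sym cyc_sym by blast+
      then show ?thesis using 3 sub card_nbrs_S(2)[of b c] b cC by simp
    next
      case 4
      then have "M b = {}" unfolding M_def by blast
      then show ?thesis by simp
    qed
  qed
  have "card (\<Union>b\<in>C - {c}. M b) \<le> (\<Sum>b\<in>C - {c}. card (M b))"
    using finite_C by (intro card_UN_le) simp
  also have "\<dots> \<le> (\<Sum>b\<in>C - {c}. 1 + (if cyc c b then 1 else 0))"
    using M by (intro sum_mono) (metis (full_types) add_0_right nat_1_add_1)
  also have "\<dots> = card (C - {c}) + card {b\<in>C - {c}. cyc c b}"
    unfolding sum.distrib using finite_C by (simp add: sum.If_cases Int_def)
  also have "\<dots> \<le> card (C - {c}) + 2"
  proof -
    have "finite {b. cyc c b}" using finite_C by (rule rev_finite_subset) (use cyc_edge in blast)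
    then have "card {b\<in>C - {c}. cyc c b} \<le> card {b. cyc c b}" by (intro card_mono) auto
    then show ?thesis using cyc_deg[OF cC] by simp
  qed
  finally have "card X \<le> 2 * card (C - {c}) + 2"
    unfolding X_def using card_Un_le[of "C - {c}" "\<Union>b\<in>C - {c}. M b"] by linarith
  moreover have "card (C - {c}) \<le> 4" using C_card cC finite_C by simp
  ultimately have "card X < 12" by simp
  moreover have "finite X" unfolding X_def using finite_C finM by auto
  ultimately have "card (f ` X) < card {..<12::nat}"
    using card_image_le[of X f] by simp
  then have "\<not> {..<12} \<subseteq> f ` X"
    using card_mono[of "f ` X" "{..<12}"] \<open>finite X\<close> by fastforce
  then obtain k where k: "k < 12" "k \<notin> f ` X" by blast
  \<comment> \<open>As \<open>c\<close> has no neighbor in \<open>S\<close>, a path of length 2 from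
    \<open>c\<close> into \<open>S\<close> has its middle vertex on the cycle.\<close>
  have near: "v \<in> X" if v: "v \<in> C \<union> S" "v \<noteq> c"
      and adj: "E c v \<or> (\<exists>w\<in>V. E c w \<and> E w v) \<or> v \<in> C" for v
  proof (cases "v \<in> C")
    case True
    then show ?thesis using v unfolding X_def by blast
  next
    case False
    then have vS: "v \<in> S" using v by blast
    then obtain w where w: "E c w" "E w v" using adj c_lone False by blast
    then have "w \<notin> S" "w \<notin> T" using c_lone vS not_E_ST by blast+
    then have "w \<in> C - {c}" using w V_cases E_V E_irrefl by blast
    then have "v \<in> M w" using w vS unfolding M_def by blast
    then show ?thesis using \<open>w \<in> C - {c}\<close> unfolding X_def by blast
  qed
  have new: "f v \<noteq> k" if "v \<in> C \<union> S" "v \<noteq> c" "E c v \<or> (\<exists>w\<in>V. E c w \<and> E w v) \<or> v \<in> C" for v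
    using near[OF that] k by blast
  have "side_coloring V E C S D (f(c := k))"
    unfolding side_coloring_def
  proof (intro conjI ballI impI)
    fix u assume "u \<in> C \<union> S - D"
    then show "(f(c := k)) u < 12" using f k(1) unfolding side_coloring_def by auto
  next
    fix u v assume u: "u \<in> C \<union> S - D" and v: "v \<in> C \<union> S - D"
      and uv: "u \<noteq> v \<and> (E u v \<or> (\<exists>w\<in>V. E u w \<and> E w v) \<or> u \<in> C \<and> v \<in> C)"
    consider "u = c" | "v = c" | "u \<noteq> c" "v \<noteq> c" by blast
    then show "(f(c := k)) u \<noteq> (f(c := k)) v"
    proof cases
      case 1
      then show ?thesis using new[of v] uv v by auto
    next
      case 2
      then have "E c u \<or> (\<exists>w\<in>V. E c w \<and> E w u) \<or> u \<in> C" using uv E_sym by blast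
      then show ?thesis using 2 new[of u] uv u by auto
    next
      case 3
      then have "u \<in> C \<union> S - insert c D" "v \<in> C \<union> S - insert c D" using u v by blast+
      then show ?thesis using f uv 3 unfolding side_coloring_def by simp
    qed
  qed
  moreover have "f x \<noteq> k" if "b \<in> bal" "x \<in> S" "E b x" for b x
  proof -
    have "x \<in> M b" "b \<in> C - {c}" using that c unfolding M_def by blast+
    then show ?thesis using k unfolding X_def by blast
  qed
  ultimately show ?thesis using that by blast
qed

text \<open>The last conclusion makes lone vertices harmless for gluing: no neighbor in
  \<open>S\<close> of a balanced vertex repeats their colors. It survives the later insertions
  because these recolor cycle vertices only.\<close>

lemma extend_lone:
  assumes "finite D" "D \<subseteq> lone_S" "side_coloring V E C S D f"
  shows "\<exists>g. side_coloring V E C S {} g \<and> (\<forall>v. v \<notin> D \<longrightarrow> g v = f v) \<and>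
    (\<forall>c\<in>D. \<forall>b\<in>bal. \<forall>x\<in>S. E b x \<longrightarrow> g x \<noteq> g c)"
  using assms
proof (induction D arbitrary: f rule: finite_induct)
  case empty
  then show ?case by blast
next
  case (insert c D)
  obtain k where k: "side_coloring V E C S D (f(c := k))"
    "\<And>b x. b \<in> bal \<Longrightarrow> x \<in> S \<Longrightarrow> E b x \<Longrightarrow> f x \<noteq> k"
    using insert_lone[OF insert.prems(2), of thesis] insert.prems(1) by blast
  obtain g where g: "side_coloring V E C S {} g" "\<And>v. v \<notin> D \<Longrightarrow> g v = (f(c := k)) v"
    "\<forall>c\<in>D. \<forall>b\<in>bal. \<forall>x\<in>S. E b x \<longrightarrow> g x \<noteq> g c"
    using insert.IH[OF _ k(1)] insert.prems(1) by blast
  have "g x \<noteq> g c" if "b \<in> bal" "x \<in> S" "E b x" for b x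
  proof -
    have "x \<notin> insert c D" using that(2) insert.prems(1) disjoint unfolding lone_def by blast
    then have "g x = f x" "g c = k" using g(2) insert.hyps by auto
    then show ?thesis using k(2)[OF that] by simp
  qed
  moreover have "g v = f v" if "v \<notin> insert c D" for v using g(2)[of v] that by simp
  ultimately show ?case using g by blast
qed

section \<open>Gluing the colorings of the two sides\<close>

text \<open>The permutation of colors must send \<open>g c\<close> to \<open>f c\<close> for
  \<open>c\<close> on the cycle. There it is forced, and \<open>sep\<close> says exactly that no
  forced value causes a conflict. Elsewhere it maps at least 7 colors to as many, while at most 5
  pairs are forbidden, so \<open>bij_betw_avoiding\<close> applies.\<close>

lemma combine:
  assumes f: "side_coloring V E C S {} f" and g: "side_coloring V E C T {} g"
    and sep: "\<And>b x y c. b \<in> bal \<Longrightarrow> x \<in> S \<Longrightarrow> y \<in> T \<Longrightarrow> E b x \<Longrightarrow> E b y \<Longrightarrow> c \<in> C \<Longrightarrow>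
      f x \<noteq> f c \<or> g y \<noteq> g c"
  shows "chi2 V E \<le> 12"
proof -
  have f12: "f ` (C \<union> S) \<subseteq> {..<12}" and g12: "g ` (C \<union> T) \<subseteq> {..<12}"
    using f g unfolding side_coloring_def by auto
  have fneq: "f u \<noteq> f v" if "u \<in> C \<union> S" "v \<in> C \<union> S" "u \<noteq> v"
    "E u v \<or> (\<exists>w\<in>V. E u w \<and> E w v) \<or> u \<in> C \<and> v \<in> C" for u v
    using f that unfolding side_coloring_def by simp
  have gneq: "g u \<noteq> g v" if "u \<in> C \<union> T" "v \<in> C \<union> T" "u \<noteq> v"
    "E u v \<or> (\<exists>w\<in>V. E u w \<and> E w v) \<or> u \<in> C \<and> v \<in> C" for u v
    using g that unfolding side_coloring_def by simp
  have fC: "inj_on f C" and gC: "inj_on g C" using fneq gneq by (auto intro!: inj_onI)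
  \<comment> \<open>A balanced vertex has one neighbor on each side and so contributes a single pair
    of colors, picked by \<open>p\<close> below; this bounds \<open>P\<close> by the number of cycle
    vertices.\<close>
  define P where "P = {(g y, f x) | x y b. b \<in> bal \<and> x \<in> S \<and> y \<in> T \<and> E b x \<and> E b y}"
  have "\<forall>b. \<exists>p. b \<in> bal \<longrightarrow>
      (\<forall>x\<in>S. \<forall>y\<in>T. E b x \<longrightarrow> E b y \<longrightarrow> p = (g y, f x))"
  proof
    fix b
    show "\<exists>p. b \<in> bal \<longrightarrow> (\<forall>x\<in>S. \<forall>y\<in>T. E b x \<longrightarrow> E b y \<longrightarrow> p = (g y, f x))"
    proof (cases "b \<in> bal")
      case True
      then obtain x y where "x \<in> S" "y \<in> T" "E b x" "E b y" "{v. E b v} = {v. cyc b v} \<union> {x, y}"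
        by (rule bal_nbrs)
      then have "\<forall>x'\<in>S. \<forall>y'\<in>T. E b x' \<longrightarrow> E b y' \<longrightarrow> x' = x \<and> y' = y"
        using cyc_edge disjoint by blast
      then show ?thesis by blast
    qed blast
  qed
  then obtain p where p: "\<And>b x y. b \<in> bal \<Longrightarrow> x \<in> S \<Longrightarrow> y \<in> T \<Longrightarrow> E b x \<Longrightarrow> E b y \<Longrightarrow>
      p b = (g y, f x)" by metis
  have P_sub: "P \<subseteq> p ` bal"
  proof
    fix q assume "q \<in> P"
    then obtain x y b where "q = (g y, f x)" "b \<in> bal" "x \<in> S" "y \<in> T" "E b x" "E b y"
      unfolding P_def by blast
    then have "q = p b" "b \<in> bal" using p[of b x y] by simp_all
    then show "q \<in> p ` bal" by (rule image_eqI)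
  qed
  have finP: "finite P" using finite_subset[OF P_sub] finite_C by simp
  have "card P \<le> card bal"
    using card_mono[OF _ P_sub] card_image_le[of bal p] finite_C by (meson finite_Diff finite_imageI order_trans)
  also have "\<dots> \<le> card C" using finite_C by (intro card_mono) auto
  finally have cardP: "card P \<le> 5" using C_card by simp
  let ?X = "{..<12} - g ` C" and ?Y = "{..<12} - f ` C"
  have sub: "g ` C \<subseteq> {..<12}" "f ` C \<subseteq> {..<12}" using f12 g12 by auto
  have cards: "card ?X = 12 - card C" "card ?Y = 12 - card C"
    using sub card_Diff_subset[of "g ` C" "{..<12}"] card_Diff_subset[of "f ` C" "{..<12}"]
      finite_C card_image[OF fC] card_image[OF gC] by simp_all
  obtain h where h: "bij_betw h ?X ?Y" "\<And>k. k \<in> ?X \<Longrightarrow> (k, h k) \<notin> P"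
  proof -
    have "finite ?X" "finite ?Y" "card ?X = card ?Y" "card P < card ?X"
      using cards cardP C_card by simp_all
    then show ?thesis using bij_betw_avoiding[OF _ _ _ finP] that by meson
  qed
  define r where "r k = (if k \<in> g ` C then f (inv_into C g k) else h k)" for k
  have rC: "r (g c) = f c" if "c \<in> C" for c
    using that gC by (simp add: r_def)
  have rG: "r k \<in> f ` C" if "k \<in> g ` C" for k using that rC by auto
  have rX: "r k \<in> ?Y" "r k = h k" if "k \<in> ?X" for k
    using that h(1) by (auto simp: r_def bij_betw_def)
  have r12: "r k < 12" if "k < 12" for k
  proof (cases "k \<in> g ` C")
    case True
    then show ?thesis using rC sub by auto
  next
    case False
    then show ?thesis using rX(1)[of k] that by auto
  qed
  have rinj: "inj_on r {..<12}"
  proof (rule inj_onI)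
    fix k l :: nat
    assume kl: "k \<in> {..<12}" "l \<in> {..<12}" "r k = r l"
    consider "k \<in> g ` C" "l \<in> g ` C" | "k \<in> ?X" "l \<in> ?X" | "k \<in> g ` C" "l \<in> ?X" | "k \<in> ?X" "l \<in> g ` C"
      using kl by blast
    then show "k = l"
    proof cases
      case 1
      then show ?thesis using rC kl(3) fC by (auto dest: inj_onD)
    next
      case 2
      then show ?thesis using rX(2) kl(3) h(1) unfolding bij_betw_def by (metis inj_onD)
    next
      case 3
      then show ?thesis using rG rX(1) kl(3) by (metis DiffD2)
    next
      case 4
      then show ?thesis using rG rX(1) kl(3) by (metis DiffD2)
    qed
  qed
  have r_avoid: "r (g y) \<noteq> f x" if b: "b \<in> bal" "x \<in> S" "y \<in> T" "E b x" "E b y" for b x y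
  proof (cases "g y \<in> g ` C")
    case True
    then obtain c where c: "c \<in> C" "g y = g c" by blast
    then have "f x \<noteq> f c" using sep[OF b c(1)] by simp
    then show ?thesis using rC[OF c(1)] c(2) by simp
  next
    case False
    then have X: "g y \<in> ?X" using g12 b(3) by auto
    have "(g y, f x) \<in> P" unfolding P_def using b by blast
    then show ?thesis using h(2)[OF X] rX(2)[OF X] by metis
  qed
  define F where "F v = (if v \<in> C \<union> S then f v else r (g v))" for v
  have FT: "F v = r (g v)" if "v \<in> C \<union> T" for v
    using that disjoint rC unfolding F_def by auto
  have FS: "F v = f v" if "v \<in> C \<union> S" for v using that unfolding F_def by simp
  \<comment> \<open>No edge joins \<open>S\<close> to \<open>T\<close>, so the common neighbor of
    \<open>u\<close> and \<open>v\<close> lies on the cycle and sees both sides: it is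
    balanced.\<close>
  have cross: "F u \<noteq> F v" if uv: "u \<in> S" "v \<in> T" "E u v \<or> (\<exists>w\<in>V. E u w \<and> E w v)" for u v
  proof -
    obtain w where w: "w \<in> V" "E w u" "E w v" using uv not_E_ST E_sym by blast
    then have "w \<in> C" using not_E_ST V_cases uv by blast
    then have "w \<in> bal" using w uv unfolding lone_def by blast
    then show ?thesis using r_avoid[of w u v] w uv FS[of u] FT[of v] by simp
  qed
  have "dist2_coloring V E F"
    unfolding dist2_coloring_def
  proof (intro ballI impI)
    fix u v assume V: "u \<in> V" "v \<in> V" and uv: "u \<noteq> v \<and> (E u v \<or> (\<exists>w\<in>V. E u w \<and> E w v))"
    have vu: "E v u \<or> (\<exists>w\<in>V. E v w \<and> E w u)" using uv E_sym by blast
    consider "u \<in> C \<union> S" "v \<in> C \<union> S" | "u \<in> C \<union> T" "v \<in> C \<union> T" | "u \<in> S" "v \<in> T" | "u \<in> T" "v \<in> S"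
      using V V_cases by blast
    then show "F u \<noteq> F v"
    proof cases
      case 1
      then show ?thesis using fneq uv FS by auto
    next
      case 2
      then have "g u \<noteq> g v" "g u < 12" "g v < 12" using gneq uv g12 by auto
      then show ?thesis using rinj FT 2 by (metis inj_onD lessThan_iff)
    next
      case 3
      then show ?thesis using cross uv by blast
    next
      case 4
      then show ?thesis using cross vu by metis
    qed
  qed
  moreover have "F ` V \<subseteq> {..<12}"
  proof (intro image_subsetI)
    fix v assume "v \<in> V"
    then consider "v \<in> C \<union> S" | "v \<in> C \<union> T" using V_cases by blast
    then show "F v \<in> {..<12}"
    proof cases
      case 1
      then show ?thesis using FS[OF 1] f12 by auto
    next
      case 2
      then show ?thesis using FT[OF 2] g12 r12[of "g v"] by auto
    qed
  qed
  ultimately show ?thesis by (rule chi2_le_if_dist2_coloring)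
qed

text \<open>A conflict needs neighbors \<open>x\<close> and \<open>y\<close> of a balanced
  \<open>b\<close> that both repeat the color of one \<open>c\<close>. If \<open>c\<close> is lone,
  its late color prevents this on one side; if \<open>c\<close> is \<open>b\<close> or next to
  \<open>b\<close>, then \<open>x\<close> is within distance 2 of \<open>c\<close>. The other
  \<open>c\<close> are left to \<open>repels\<close>, which the extension preserves because it
  changes lone vertices only.\<close>

lemma chi2_le_12:
  assumes f: "side_coloring V E C S lone_S f" and g: "side_coloring V E C T lone_T g"
    and sep: "\<And>a b. a \<in> bal \<Longrightarrow> b \<in> bal \<Longrightarrow> a \<noteq> b \<Longrightarrow> cyc a b \<or> repels E S f a b \<or> repels E T g a b"
  shows "chi2 V E \<le> 12"
proof -
  interpret sw: plane_cycle V E pos crv cyc C J B A T S by (rule swap)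
  have fin: "finite lone_S" "finite lone_T" using finite_C unfolding lone_def by auto
  obtain f' where f': "side_coloring V E C S {} f'" "\<And>v. v \<notin> lone_S \<Longrightarrow> f' v = f v"
    "\<And>c b x. c \<in> lone_S \<Longrightarrow> b \<in> bal \<Longrightarrow> x \<in> S \<Longrightarrow> E b x \<Longrightarrow> f' x \<noteq> f' c"
    using extend_lone[OF fin(1) order.refl f] by blast
  obtain g' where g': "side_coloring V E C T {} g'" "\<And>v. v \<notin> lone_T \<Longrightarrow> g' v = g v"
    "\<And>c b x. c \<in> lone_T \<Longrightarrow> b \<in> bal \<Longrightarrow> x \<in> T \<Longrightarrow> E b x \<Longrightarrow> g' x \<noteq> g' c"
    using sw.extend_lone[OF fin(2) order.refl g] by blast
  show ?thesis
  proof (rule combine[OF f'(1) g'(1)])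
    fix b x y c
    assume b: "b \<in> bal" "x \<in> S" "y \<in> T" "E b x" "E b y" and c: "c \<in> C"
    have x: "x \<notin> lone_S" "y \<notin> lone_T" using b disjoint unfolding lone_def by blast+
    consider "c \<in> lone_S" | "c \<in> lone_T" | "c = b" | "c \<in> bal" "cyc b c"
      | "c \<in> bal" "repels E S f b c" | "c \<in> bal" "repels E T g b c"
      using sep[OF b(1), of c] c by blast
    then show "f' x \<noteq> f' c \<or> g' y \<noteq> g' c"
    proof cases
      case 1
      then show ?thesis using f'(3) b by blast
    next
      case 2
      then show ?thesis using g'(3) b by blast
    next
      case 3
      then have "x \<noteq> c" "E x c" using b c disjoint E_sym by blast+
      then show ?thesis using f'(1) b c unfolding side_coloring_def by blast
    next
      case 4
      then have "E x b" "E b c" "x \<noteq> c" "b \<in> V"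
        using b c disjoint E_sym cyc_edge E_V by blast+
      then show ?thesis using f'(1) b(2) c unfolding side_coloring_def by blast
    next
      case 5
      then show ?thesis using b x f'(2)[of c] f'(2)[of x] unfolding repels_def by auto
    next
      case 6
      then show ?thesis using b x g'(2)[of c] g'(2)[of y] unfolding repels_def by auto
    qed
  qed
qed

subsection \<open>Smaller graphs on one side\<close>

text \<open>Chords are excluded wherever they are drawn, but only between vertices that are not
  lone. Then \<open>base\<close> keeps nothing drawn in \<open>B\<close>, which is left free for a
  new chord.\<close>

definition rim_only :: bool where
  "rim_only \<longleftrightarrow> (\<forall>u\<in>C - lone_S. \<forall>v\<in>C - lone_S. E u v \<longrightarrow> cyc u v)"

text \<open>\<open>F\<close> may lose edges at lone vertices, as these are recolored later, but must
  see every other edge of the side. The last condition takes over from \<open>cyc_diam\<close> after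
  the deletion of \<open>D\<close>: the remaining rim is still colored injectively.\<close>

definition reduction :: "'a set \<Rightarrow> ('a \<Rightarrow> 'a \<Rightarrow> bool) \<Rightarrow> bool" where
  "reduction D F \<longleftrightarrow> D \<subseteq> lone_S \<and> in_F (C \<union> S - D) F \<and>
     (\<forall>u\<in>C \<union> S - lone_S. \<forall>v\<in>C \<union> S - lone_S. E u v \<longrightarrow> F u v) \<and>
     (\<forall>u\<in>C - D. \<forall>v\<in>C - D. u \<noteq> v \<longrightarrow> F u v \<or> (\<exists>w\<in>C - D. F u w \<and> F w v))"

lemma reductionD:
  assumes "reduction D F"
  shows "D \<subseteq> lone_S" "in_F (C \<union> S - D) F"
    "\<And>u v. u \<in> C \<union> S - lone_S \<Longrightarrow> v \<in> C \<union> S - lone_S \<Longrightarrow> E u v \<Longrightarrow> F u v"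
    "\<And>u v. u \<in> C - D \<Longrightarrow> v \<in> C - D \<Longrightarrow> u \<noteq> v \<Longrightarrow> F u v \<or> (\<exists>w\<in>C - D. F u w \<and> F w v)"
proof -
  note R = assms[unfolded reduction_def]
  show "D \<subseteq> lone_S" by (rule R[THEN conjunct1])
  show "in_F (C \<union> S - D) F" by (rule R[THEN conjunct2, THEN conjunct1])
  show "F u v" if "u \<in> C \<union> S - lone_S" "v \<in> C \<union> S - lone_S" "E u v" for u v
    by (rule R[THEN conjunct2, THEN conjunct2, THEN conjunct1, rule_format, OF that])
  show "F u v \<or> (\<exists>w\<in>C - D. F u w \<and> F w v)" if "u \<in> C - D" "v \<in> C - D" "u \<noteq> v" for u v
    by (rule R[THEN conjunct2, THEN conjunct2, THEN conjunct2, rule_format, OF that])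
qed

text \<open>Minimality applies because the nonempty \<open>T\<close> is missing. Between vertices
  that are not lone, a path of length 2 with an end in \<open>S\<close> has its middle in
  \<open>C\<close> or \<open>S\<close>, and the middle is not lone either, so the path survives in
  \<open>F\<close>. Two cycle vertices are told apart by the last condition of
  \<open>reduction\<close>.\<close>

lemma reduction_coloring:
  assumes "reduction D F"
  shows "\<exists>f. side_coloring V E C S lone_S f \<and>
    (\<forall>a\<in>C - D. \<forall>b\<in>C - D. F a b \<longrightarrow> repels E S f a b)"
proof -
  let ?W = "C \<union> S - D"
  note D = reductionD(1)[OF assms] and inF = reductionD(2)[OF assms]
    and FE = reductionD(3)[OF assms] and rainbow = reductionD(4)[OF assms]
  have Fsym: "F u v \<Longrightarrow> F v u" for u v
    using inF unfolding in_F_def simple_graph_def by blast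
  obtain y where y: "y \<in> T" using nonempty by blast
  have sub: "?W \<subset> V" using y disjoint V_cases by blast
  have fin: "finite ?W" using sub finite_V finite_subset by blast
  obtain f where f: "dist2_coloring ?W F f" "f ` ?W \<subseteq> {..<12}"
    using dist2_coloring_if_chi2_le[OF fin smaller[OF inF]] psubset_card_mono[OF finite_V sub] by blast
  have neq: "f u \<noteq> f v" if "u \<in> ?W" "v \<in> ?W" "u \<noteq> v" "F u v \<or> (\<exists>w\<in>?W. F u w \<and> F w v)" for u v
    using f(1) that unfolding dist2_coloring_def by blast
  have SW: "x \<in> C \<union> S - lone_S" if "x \<in> S" for x
    using that disjoint unfolding lone_def by blast
  have nbrS: "w \<in> C \<union> S - lone_S" if "x \<in> S" "E x w" for x w
    using that V_cases not_E_ST E_V E_sym disjoint unfolding lone_def by blast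
  have "side_coloring V E C S lone_S f"
    unfolding side_coloring_def
  proof (intro conjI ballI impI)
    fix u assume "u \<in> C \<union> S - lone_S"
    then show "f u < 12" using f(2) D by auto
  next
    fix u v assume u: "u \<in> C \<union> S - lone_S" and v: "v \<in> C \<union> S - lone_S"
      and uv: "u \<noteq> v \<and> (E u v \<or> (\<exists>w\<in>V. E u w \<and> E w v) \<or> u \<in> C \<and> v \<in> C)"
    have W: "u \<in> ?W" "v \<in> ?W" using u v D by blast+
    consider "E u v" | "u \<in> C" "v \<in> C" | w where "E u w" "E w v" "u \<in> S \<or> v \<in> S"
      using uv u v by blast
    then show "f u \<noteq> f v"
    proof cases
      case 1
      then show ?thesis using neq[OF W] uv FE[OF u v] by blast
    next
      case 2
      then show ?thesis using neq[OF W] uv rainbow[of u v] W by blast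
    next
      case 3
      then have w: "w \<in> C \<union> S - lone_S" using nbrS E_sym by blast
      then have "F u w" "F w v" using FE u v 3 by blast+
      then show ?thesis using neq[OF W] uv w D by blast
    qed
  qed
  moreover have "f x \<noteq> f b" if ab: "a \<in> C - D" "b \<in> C - D" "F a b" "x \<in> S" "E a x" for a b x
  proof -
    have "F x a" using FE[of x a] SW[of x] nbrS[of x a] E_sym ab by blast
    moreover have "x \<noteq> b" "x \<in> ?W" using ab disjoint D unfolding lone_def by blast+
    ultimately show ?thesis using neq[of x b] ab by blast
  qed
  ultimately show ?thesis unfolding repels_def using Fsym by blast
qed

text \<open>Chords of the cycle with a lone end impose no constraint on a coloring that ignores the lone
  vertices. Dropping them keeps the side \<open>B\<close> free for a new chord.\<close>

definition base :: "'a set \<Rightarrow> 'a \<Rightarrow> 'a \<Rightarrow> bool" where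
  "base D u v \<longleftrightarrow> E u v \<and> u \<in> C \<union> S - D \<and> v \<in> C \<union> S - D \<and>
     (cyc u v \<or> u \<notin> lone_S \<and> v \<notin> lone_S)"

text \<open>Keeps two resources in reserve for one more chord: a free place at every balanced vertex
  and, under \<open>rim_only\<close>, an empty region \<open>B\<close>.\<close>

definition drawn :: "'a set \<Rightarrow> ('a \<Rightarrow> 'a \<Rightarrow> bool) \<Rightarrow> ('a \<Rightarrow> 'a \<Rightarrow> real \<Rightarrow> complex) \<Rightarrow> bool" where
  "drawn D F c \<longleftrightarrow> simple_graph (C \<union> S - D) F \<and> plane_embedding (C \<union> S - D) F pos c \<and>
     max_degree_le (C \<union> S - D) F 4 \<and>
     (\<forall>b\<in>bal. card {v\<in>C \<union> S - D. F b v} \<le> 3) \<and>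
     (rim_only \<longrightarrow> (\<forall>u v. F u v \<longrightarrow> path_image (c u v) \<inter> B = {}))"

lemma base_graph: "simple_graph (C \<union> S - D) (base D)"
  and base_embedding: "plane_embedding (C \<union> S - D) (base D) pos crv"
proof -
  have sub: "C \<union> S - D \<subseteq> V" using V_cases by blast
  then have "finite (C \<union> S - D)" using finite_V finite_subset by blast
  then show "simple_graph (C \<union> S - D) (base D)"
    unfolding simple_graph_def base_def using E_sym E_irrefl cyc_sym by blast
  show "plane_embedding (C \<union> S - D) (base D) pos crv"
    by (rule plane_embedding_mono[OF emb sub]) (auto simp: base_def)
qed

text \<open>Rim edges run in \<open>J\<close>. Under \<open>rim_only\<close> every other edge of
  \<open>base D\<close> has an end in \<open>S\<close>, and its curve stays in \<open>A\<close> up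
  to the other end.\<close>

lemma base_outside_B:
  assumes "rim_only" "base D u v"
  shows "path_image (crv u v) \<inter> B = {}"
proof -
  have uv: "E u v" "E v u" using assms(2) E_sym unfolding base_def by blast+
  have img: "path_image (crv u v) = path_image (crv v u)" using plane_embeddingD(5)[OF emb uv(1)] .
  have CS: "u \<in> C \<union> S" "v \<in> C \<union> S" using assms(2) unfolding base_def by blast+
  then have "pos u \<notin> B" "pos v \<notin> B" using V_cases disjoint unfolding T_def by blast+
  consider "cyc u v" | "u \<in> S" | "v \<in> S"
    using assms CS unfolding rim_only_def base_def by blast
  then show ?thesis
  proof cases
    case 1
    then show ?thesis using regions unfolding J_eq by blast
  next
    case 2
    then show ?thesis using edge_from_S(1)[OF uv(1)] regions \<open>pos v \<notin> B\<close> by blast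
  next
    case 3
    then show ?thesis using edge_from_S(1)[OF uv(2)] regions \<open>pos u \<notin> B\<close> img by blast
  qed
qed

text \<open>\<open>X\<close> stands for neighbors lost in passing to the smaller graph; each of them
  frees one place at \<open>u\<close>.\<close>

lemma base_degree:
  assumes "finite X" "\<And>x. x \<in> X \<Longrightarrow> E u x \<and> x \<notin> C \<union> S - D"
  shows "card {v\<in>C \<union> S - D. base D u v} + card X \<le> 4"
proof -
  have "finite {v\<in>C \<union> S - D. base D u v}"
    using finite_nbrs[of u] by (rule rev_finite_subset) (auto simp: base_def)
  then have "card {v\<in>C \<union> S - D. base D u v} + card X = card ({v\<in>C \<union> S - D. base D u v} \<union> X)"
    using assms by (intro card_Un_disjoint[symmetric]) auto
  also have "\<dots> \<le> card {v. E u v}"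
    using assms by (intro card_mono finite_nbrs) (auto simp: base_def)
  finally show ?thesis using card_nbrs[of u] by simp
qed

lemma bal_nbr_T: "b \<in> bal \<Longrightarrow> \<exists>y\<in>T. E b y \<and> y \<notin> C \<union> S"
  using disjoint by (elim bal_nbrs) blast

lemma drawn_base: "drawn {} (base {}) crv"
proof -
  have "card {v\<in>C \<union> S - {}. base {} b v} \<le> 3" if b: "b \<in> bal" for b
  proof -
    obtain y where "y \<in> T" "E b y" "y \<notin> C \<union> S" using bal_nbr_T[OF b] by blast
    then show ?thesis using base_degree[of "{y}" b "{}"] by simp
  qed
  moreover have "card {v\<in>C \<union> S - {}. base {} u v} \<le> 4" for u
    using base_degree[of "{}" u "{}"] by simp
  ultimately show ?thesis
    unfolding drawn_def max_degree_le_def using base_graph base_embedding base_outside_B by metis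
qed

lemma reductionI:
  assumes "drawn D F c" "D \<subseteq> lone_S" "\<And>u v. base D u v \<Longrightarrow> F u v"
    and "\<And>u v. u \<in> C - D \<Longrightarrow> v \<in> C - D \<Longrightarrow> u \<noteq> v \<Longrightarrow> F u v \<or> (\<exists>w\<in>C - D. F u w \<and> F w v)"
  shows "reduction D F"
proof -
  have "in_F (C \<union> S - D) F"
    using assms(1) unfolding drawn_def in_F_def planar_def by blast
  moreover have "F u v" if "u \<in> C \<union> S - lone_S" "v \<in> C \<union> S - lone_S" "E u v" for u v
    using that assms(2,3) unfolding base_def by blast
  ultimately show ?thesis using assms unfolding reduction_def by blast
qed

section \<open>Chords through the other side and smoothed paths\<close>

text \<open>Balanced vertices have neighbors in \<open>T\<close>, and the edges to them give access
  to \<open>B\<close> from its boundary; a path in the connected region \<open>B\<close> links their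
  far ends. The joined path may meet itself, so an arc is extracted from it.\<close>

lemma chord_arc:
  assumes ab: "a \<in> bal" "b \<in> bal" "a \<noteq> b"
  obtains \<gamma> where "arc \<gamma>" "pathstart \<gamma> = pos a" "pathfinish \<gamma> = pos b"
    "path_image \<gamma> \<subseteq> B \<union> {pos a, pos b}"
proof -
  interpret sw: plane_cycle V E pos crv cyc C J B A T S by (rule swap)
  obtain y where y: "y \<in> T" "E a y" using ab bal_nbr_T by blast
  obtain z where z: "z \<in> T" "E b z" using ab bal_nbr_T by blast
  have legs: "path_image (crv u v) \<subseteq> B \<union> {pos u}" if "E u v" "v \<in> T" for u v
    using sw.edge_from_S(1)[of v u] plane_embeddingD(5)[OF emb that(1)] E_sym that by blast
  have "path_connected B" using B connected_open_path_connected by blast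
  then obtain p where p: "path p" "path_image p \<subseteq> B" "pathstart p = pos y" "pathfinish p = pos z"
    using y(1) z(1) unfolding path_connected_def T_def by blast
  note Da = plane_embeddingD(2-4)[OF emb y(2)] and Db = plane_embeddingD(2-4)[OF emb z(2)]
  let ?q = "crv a y +++ p +++ reversepath (crv b z)"
  have q: "path ?q" "pathstart ?q = pos a" "pathfinish ?q = pos b"
    using Da Db p by (simp_all add: arc_imp_path)
  have "path_image ?q \<subseteq> B \<union> {pos a, pos b}"
    using Da Db p legs[OF y(2,1)] legs[OF z(2,1)] by (auto simp: path_image_join)
  moreover have "pos a \<noteq> pos b"
    using plane_embeddingD(1)[OF emb] ab C_sub by (auto dest: inj_onD)
  then obtain \<gamma> where "arc \<gamma>" "path_image \<gamma> \<subseteq> path_image ?q" "pathstart \<gamma> = pos a" "pathfinish \<gamma> = pos b"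
    using path_contains_arc[OF q] by metis
  ultimately show ?thesis using that[of \<gamma>] by (meson order_trans)
qed

text \<open>The missing neighbors in \<open>T\<close> leave a free place at both ends, and by
  \<open>rim_only\<close> nothing else is drawn in \<open>B\<close>. The remaining conditions of
  \<open>reduction\<close> persist when edges are added.\<close>

lemma reduction_chord:
  assumes F: "drawn D F c" "reduction D F" and rim: rim_only
    and ab: "a \<in> bal" "b \<in> bal" "a \<noteq> b"
  shows "reduction D (add_edge F a b)"
proof -
  let ?W = "C \<union> S - D"
  note D = reductionD(1)[OF F(2)]
  have gr: "simple_graph ?W F" and em: "plane_embedding ?W F pos c"
    using F(1) unfolding drawn_def by blast+
  have W: "a \<in> ?W" "b \<in> ?W" using ab D by blast+
  obtain \<gamma> where \<gamma>: "arc \<gamma>" "pathstart \<gamma> = pos a" "pathfinish \<gamma> = pos b"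
    "path_image \<gamma> \<subseteq> B \<union> {pos a, pos b}" using chord_arc[OF ab] by blast
  have "B \<inter> pos ` ?W = {}" using V_cases disjoint unfolding T_def by blast
  then have "plane_embedding ?W (add_edge F a b) pos (add_arc c a b \<gamma>)"
    using F(1) rim \<gamma>(4) unfolding drawn_def
    by (intro plane_embedding_add_edge[OF gr em W ab(3) \<gamma>(1-3)]) blast+
  moreover have "simple_graph ?W (add_edge F a b)"
    using simple_graph_add_edge[OF gr W ab(3)] .
  moreover have "card {v\<in>?W. add_edge F a b u v} \<le> 4" if "u \<in> ?W" for u
  proof -
    have fin: "finite ?W" using gr unfolding simple_graph_def by blast
    have "card {v\<in>?W. F u v} \<le> 4" "u \<in> bal \<longrightarrow> card {v\<in>?W. F u v} \<le> 3"
      using F(1) that unfolding drawn_def max_degree_le_def by blast+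
    then show ?thesis using card_nbrs_add_edge[OF fin, of F a b u] ab by (auto split: if_splits)
  qed
  ultimately have "in_F ?W (add_edge F a b)"
    unfolding in_F_def planar_def max_degree_le_def by blast
  then show ?thesis unfolding reduction_def
  proof (intro conjI ballI impI)
    show "D \<subseteq> lone_S" by (rule D)
    fix u v assume "u \<in> C \<union> S - lone_S" "v \<in> C \<union> S - lone_S" "E u v"
    then show "add_edge F a b u v"
      using reductionD(3)[OF F(2), of u v] unfolding add_edge_def by blast
  next
    fix u v assume "u \<in> C - D" "v \<in> C - D" "u \<noteq> v"
    then show "add_edge F a b u v \<or> (\<exists>w\<in>C - D. add_edge F a b u w \<and> add_edge F a b w v)"
      using reductionD(4)[OF F(2), of u v] unfolding add_edge_def by blast
  qed
qed

lemma base_reduction: "reduction {} (base {})"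
proof (rule reductionI[OF drawn_base])
  fix u v assume "u \<in> C - {}" "v \<in> C - {}" "u \<noteq> v"
  then show "base {} u v \<or> (\<exists>w\<in>C - {}. base {} u w \<and> base {} w v)"
    using cyc_diam[of u v] cyc_edge unfolding base_def by blast
qed auto

lemma ex_coloring: "\<exists>f. side_coloring V E C S lone_S f"
  using reduction_coloring[OF base_reduction] by blast

lemma ex_coloring_chord:
  assumes "rim_only" "a \<in> bal" "b \<in> bal" "a \<noteq> b"
  shows "\<exists>f. side_coloring V E C S lone_S f \<and> repels E S f a b"
  using reduction_coloring[OF reduction_chord[OF drawn_base base_reduction assms]] assms
  unfolding add_edge_def by blast

text \<open>The path \<open>a, c, b\<close> of the cycle is replaced by an edge, so that \<open>c\<close> disappears.\<close>

lemma smoothing: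
  assumes c: "c \<in> lone_S" and ac: "cyc a c" and cb: "cyc c b" and ab: "a \<noteq> b"
    and diam: "\<forall>u\<in>C - {c}. \<forall>v\<in>C - {c}. u \<noteq> v \<longrightarrow>
      add_edge cyc a b u v \<or> (\<exists>w\<in>C - {c}. add_edge cyc a b u w \<and> add_edge cyc a b w v)"
  defines "F \<equiv> add_edge (base {c}) a b"
  shows "\<exists>crv'. drawn {c} F crv'" and "reduction {c} F"
proof -
  let ?W = "C \<union> S - {c}" and ?\<gamma> = "crv a c +++ crv c b"
  note gr = base_graph[of "{c}"] and em = base_embedding[of "{c}"]
  have E: "E a c" "E c b" using ac cb cyc_edge by blast+
  have W: "a \<in> ?W" "b \<in> ?W" using ac cb cyc_edge E_irrefl by blast+
  \<comment> \<open>As \<open>a \<noteq> b\<close>, these are two different edges, so their curves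
    share only the common end.\<close>
  have meet: "path_image (crv a c) \<inter> path_image (crv c b) \<subseteq> {pos c}"
    using plane_embeddingD(7)[OF emb E] ab W by (auto simp: doubleton_eq_iff)
  have \<gamma>: "arc ?\<gamma>" "pathstart ?\<gamma> = pos a" "pathfinish ?\<gamma> = pos b"
    using plane_embeddingD(2-4)[OF emb E(1)] plane_embeddingD(2-4)[OF emb E(2)] meet
    by (auto intro!: arc_join)
  have img: "path_image ?\<gamma> = path_image (crv a c) \<union> path_image (crv c b)"
    using plane_embeddingD(2-4)[OF emb E(1)] plane_embeddingD(2-4)[OF emb E(2)]
    by (simp add: path_image_join)
  have sub: "?W \<subseteq> V" "c \<in> V" using V_cases c unfolding lone_def by blast+
  have join_meet: "X \<inter> N \<subseteq> {x, z} \<Longrightarrow> Y \<inter> N \<subseteq> {z, y} \<Longrightarrow> z \<notin> N \<Longrightarrow> (X \<union> Y) \<inter> N \<subseteq> {x, y}"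
    for X Y N :: "complex set" and x y z by blast
  have "pos c \<notin> pos ` ?W"
    using plane_embeddingD(1)[OF emb] sub by (auto dest: inj_onD)
  moreover have "path_image (crv a c) \<inter> pos ` ?W \<subseteq> {pos a, pos c}"
    "path_image (crv c b) \<inter> pos ` ?W \<subseteq> {pos c, pos b}"
    using Int_mono[OF order.refl image_mono[OF sub(1)]]
      plane_embeddingD(6)[OF emb E(1)] plane_embeddingD(6)[OF emb E(2)] by metis+
  ultimately have \<gamma>W: "path_image ?\<gamma> \<inter> pos ` ?W \<subseteq> {pos a, pos b}"
    unfolding img by (rule join_meet[rotated 2])
  have \<gamma>F: "path_image ?\<gamma> \<inter> path_image (crv u v) \<subseteq> {pos a, pos b}" if uv: "base {c} u v" for u v
  proof -
    have uv: "E u v" "u \<noteq> c" "v \<noteq> c" using uv unfolding base_def by blast+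
    then have neq: "{a, c} \<noteq> {u, v}" "{c, b} \<noteq> {u, v}" by (auto simp: doubleton_eq_iff)
    have "pos ` ({a, c} \<inter> {u, v}) \<subseteq> pos ` {a}" "pos ` ({c, b} \<inter> {u, v}) \<subseteq> pos ` {b}"
      using uv by (intro image_mono; blast)+
    then have "path_image (crv a c) \<inter> path_image (crv u v) \<subseteq> {pos a}"
      "path_image (crv c b) \<inter> path_image (crv u v) \<subseteq> {pos b}"
      using plane_embeddingD(7)[OF emb E(1) uv(1) neq(1)] plane_embeddingD(7)[OF emb E(2) uv(1) neq(2)]
      by simp_all
    then show ?thesis unfolding img by (simp only: Int_Un_distrib2) blast
  qed
  have fin: "finite ?W" using gr unfolding simple_graph_def by blast
  have gr': "simple_graph ?W F" unfolding F_def using simple_graph_add_edge[OF gr W ab] .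
  have em': "plane_embedding ?W F pos (add_arc crv a b ?\<gamma>)"
    unfolding F_def using plane_embedding_add_edge[OF gr em W ab \<gamma> \<gamma>W \<gamma>F] .
  have deg: "card {v\<in>?W. F u v} + card X \<le> 4"
    if X: "finite X" "\<And>x. x \<in> X \<Longrightarrow> E u x \<and> x \<notin> C \<union> S" for u X
  proof -
    \<comment> \<open>At \<open>a\<close> and \<open>b\<close> the lost neighbor \<open>c\<close>
      makes up for the new edge, which is why \<open>c\<close> joins \<open>X\<close> in the
      count.\<close>
    have "card {v\<in>?W. base {c} u v} + card X + (if u = a \<or> u = b then 1 else 0) \<le> 4"
    proof (cases "u = a \<or> u = b")
      case True
      have "c \<notin> X" using X c unfolding lone_def by blast
      moreover have "E u c" using True E E_sym by blast
      ultimately show ?thesis using base_degree[of "insert c X" u "{c}"] X True by auto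
    next
      case False
      then show ?thesis using base_degree[of X u "{c}"] X by auto
    qed
    then show ?thesis using card_nbrs_add_edge[OF fin, of "base {c}" a b u] unfolding F_def by linarith
  qed
  have "card {v\<in>?W. F u v} \<le> 4" for u using deg[of "{}" u] by simp
  then have md: "max_degree_le ?W F 4" unfolding max_degree_le_def by blast
  have bal3: "card {v\<in>?W. F u v} \<le> 3" if u: "u \<in> bal" for u
  proof -
    obtain y where "y \<in> T" "E u y" "y \<notin> C \<union> S" using bal_nbr_T[OF u] by blast
    then show ?thesis using deg[of "{y}" u] by simp
  qed
  \<comment> \<open>The new arc runs along the cycle and not through \<open>B\<close>, so the
    smoothed graph can still receive a chord.\<close>
  have "path_image ?\<gamma> \<subseteq> J" unfolding img J_eq using ac cb by blast
  then have \<gamma>B: "path_image ?\<gamma> \<inter> B = {}" using regions by blast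
  have "path_image (add_arc crv a b ?\<gamma> u v) \<inter> B = {}" if rim_only "F u v" for u v
  proof (cases "{u, v} = {a, b}")
    case True
    then show ?thesis using \<gamma>B path_image_add_arc(1)[OF True] by metis
  next
    case False
    then have "base {c} u v" using that(2) unfolding F_def add_edge_def by blast
    then show ?thesis using base_outside_B[OF that(1)] path_image_add_arc(2)[OF False] by metis
  qed
  then have dr: "drawn {c} F (add_arc crv a b ?\<gamma>)"
    unfolding drawn_def using gr' em' md bal3 by blast
  then show "\<exists>crv'. drawn {c} F crv'" by blast
  show "reduction {c} F"
  proof (rule reductionI[OF dr])
    have cycF: "F u v" if "add_edge cyc a b u v" "u \<noteq> c" "v \<noteq> c" for u v
      using that cyc_edge unfolding F_def add_edge_def base_def by blast
    fix u v assume uv: "u \<in> C - {c}" "v \<in> C - {c}" "u \<noteq> v"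
    show "F u v \<or> (\<exists>w\<in>C - {c}. F u w \<and> F w v)"
      using diam[rule_format, OF uv] cycF uv by blast
  qed (use c in \<open>auto simp: F_def add_edge_def\<close>)
qed

subsection \<open>Cycles of length 3, 4 and 5\<close>

lemma chi2_le_12_triangle:
  assumes "\<And>u v. u \<in> C \<Longrightarrow> v \<in> C \<Longrightarrow> u \<noteq> v \<Longrightarrow> cyc u v"
  shows "chi2 V E \<le> 12"
proof -
  interpret sw: plane_cycle V E pos crv cyc C J B A T S by (rule swap)
  obtain f g where "side_coloring V E C S lone_S f" "side_coloring V E C T lone_T g"
    using ex_coloring sw.ex_coloring by blast
  then show ?thesis by (rule chi2_le_12) (use assms in blast)
qed

lemma bal_edge_cyc': "E u v \<Longrightarrow> u \<in> C \<Longrightarrow> v \<in> C \<Longrightarrow> u \<in> bal \<or> v \<in> bal \<Longrightarrow> cyc u v"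
  using bal_edge_cyc E_sym cyc_sym by blast

text \<open>All chords share the end \<open>y\<close>. If \<open>y\<close> is lone for a side, they
  do not count on that side; if \<open>y\<close> is balanced, there are none.\<close>

lemma rim_only_either_side:
  assumes y: "y \<in> C" and edge: "\<forall>u\<in>C. \<forall>v\<in>C. E u v \<longrightarrow> cyc u v \<or> u = y \<or> v = y"
  shows "rim_only \<or> plane_cycle.rim_only E cyc C T"
proof -
  interpret sw: plane_cycle V E pos crv cyc C J B A T S by (rule swap)
  have *: "\<forall>u\<in>C - L. \<forall>v\<in>C - L. E u v \<longrightarrow> cyc u v" if "y \<in> L \<or> y \<in> bal" for L
    using that edge bal_edge_cyc' by blast
  show ?thesis using *[of lone_S] *[of lone_T] y unfolding rim_only_def sw.rim_only_def by blast
qed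

text \<open>If both diagonals have balanced ends, the cycle has no chord in G, and each smaller
  graph takes one diagonal. If only one has, it goes to a side where \<open>rim_only\<close> holds.
  On the side \<open>S\<close> the graph \<open>F\<close> is left general, so that both
  \<open>base\<close> and the smoothed graph fit; the side \<open>T\<close> always uses
  \<open>base\<close>.\<close>

lemma colorings_across_diagonals:
  assumes F: "drawn D F crv'" "reduction D F"
    and C: "y \<in> C" "z \<in> C" and neq: "x \<noteq> z" "y \<noteq> w"
    and xz: "x \<in> bal \<and> z \<in> bal \<longrightarrow> (\<forall>u\<in>C. \<forall>v\<in>C. E u v \<longrightarrow> cyc u v \<or> u = y \<or> v = y)"
    and yw: "y \<in> bal \<and> w \<in> bal \<longrightarrow> (\<forall>u\<in>C. \<forall>v\<in>C. E u v \<longrightarrow> cyc u v \<or> u = z \<or> v = z)"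
  obtains f g where "side_coloring V E C S lone_S f" "side_coloring V E C T lone_T g"
    "\<forall>a\<in>C - D. \<forall>b\<in>C - D. F a b \<longrightarrow> repels E S f a b"
    "x \<in> bal \<and> z \<in> bal \<longrightarrow> repels E S f x z \<or> repels E T g x z"
    "y \<in> bal \<and> w \<in> bal \<longrightarrow> repels E S f y w \<or> repels E T g y w"
proof -
  interpret sw: plane_cycle V E pos crv cyc C J B A T S by (rule swap)
  note D = reductionD(1)[OF F(2)]
  have S_plain: "\<exists>f. side_coloring V E C S lone_S f \<and>
      (\<forall>a\<in>C - D. \<forall>b\<in>C - D. F a b \<longrightarrow> repels E S f a b)"
    using reduction_coloring[OF F(2)] .
  have S_chord: "\<exists>f. side_coloring V E C S lone_S f \<and>
      (\<forall>a\<in>C - D. \<forall>b\<in>C - D. F a b \<longrightarrow> repels E S f a b) \<and> repels E S f p q"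
    if "rim_only" "p \<in> bal" "q \<in> bal" "p \<noteq> q" for p q
  proof -
    have "p \<in> C - D" "q \<in> C - D" using that D by blast+
    moreover have "add_edge F p q p q" "F a b \<Longrightarrow> add_edge F p q a b" for a b
      unfolding add_edge_def by blast+
    ultimately show ?thesis
      using reduction_coloring[OF reduction_chord[OF F that]] by metis
  qed
  obtain g0 where g0: "side_coloring V E C T lone_T g0" using sw.ex_coloring by blast
  have T_chord: "\<exists>g. side_coloring V E C T lone_T g \<and> repels E T g p q"
    if "sw.rim_only" "p \<in> bal" "q \<in> bal" "p \<noteq> q" for p q
    using sw.ex_coloring_chord[OF that(1) _ _ that(4)] that(2,3) by blast
  have single: "\<exists>f g. side_coloring V E C S lone_S f \<and> side_coloring V E C T lone_T g \<and>
      (\<forall>a\<in>C - D. \<forall>b\<in>C - D. F a b \<longrightarrow> repels E S f a b) \<and> (repels E S f p q \<or> repels E T g p q)"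
    if "rim_only \<or> sw.rim_only" "p \<in> bal" "q \<in> bal" "p \<noteq> q" for p q
    using that(1)
  proof
    assume rim_only
    then show ?thesis using S_chord[OF _ that(2-4)] g0 by blast
  next
    assume sw.rim_only
    then show ?thesis using T_chord[OF _ that(2-4)] S_plain by blast
  qed
  consider "x \<in> bal" "z \<in> bal" "y \<in> bal" "w \<in> bal" | "x \<in> bal" "z \<in> bal" "\<not> (y \<in> bal \<and> w \<in> bal)"
    | "\<not> (x \<in> bal \<and> z \<in> bal)" "y \<in> bal" "w \<in> bal" | "\<not> (x \<in> bal \<and> z \<in> bal)" "\<not> (y \<in> bal \<and> w \<in> bal)"
    by argo
  then show ?thesis
  proof cases
    case 1
    then have "cyc u v" if "u \<in> C" "v \<in> C" "E u v" for u v
      using bal_edge_cyc' that xz by blast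
    then have "rim_only" "sw.rim_only" unfolding rim_only_def sw.rim_only_def by blast+
    then obtain f g where "side_coloring V E C S lone_S f"
      "\<forall>a\<in>C - D. \<forall>b\<in>C - D. F a b \<longrightarrow> repels E S f a b" "repels E S f x z"
      "side_coloring V E C T lone_T g" "repels E T g y w"
      using S_chord[OF _ 1(1,2) neq(1)] T_chord[OF _ 1(3,4) neq(2)] by metis
    then show ?thesis by (intro that[of f g]) blast+
  next
    case 2
    have "rim_only \<or> sw.rim_only" by (rule rim_only_either_side[OF C(1)]) (use xz 2 in blast)
    then obtain f g where "side_coloring V E C S lone_S f" "side_coloring V E C T lone_T g"
      "\<forall>a\<in>C - D. \<forall>b\<in>C - D. F a b \<longrightarrow> repels E S f a b" "repels E S f x z \<or> repels E T g x z"
      using single[OF _ 2(1,2) neq(1)] by metis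
    then show ?thesis using 2(3) by (intro that[of f g]) blast+
  next
    case 3
    have "rim_only \<or> sw.rim_only" by (rule rim_only_either_side[OF C(2)]) (use yw 3 in blast)
    then obtain f g where "side_coloring V E C S lone_S f" "side_coloring V E C T lone_T g"
      "\<forall>a\<in>C - D. \<forall>b\<in>C - D. F a b \<longrightarrow> repels E S f a b" "repels E S f y w \<or> repels E T g y w"
      using single[OF _ 3(2,3) neq(2)] by metis
    then show ?thesis using 3(1) by (intro that[of f g]) blast+
  next
    case 4
    obtain f where "side_coloring V E C S lone_S f"
      "\<forall>a\<in>C - D. \<forall>b\<in>C - D. F a b \<longrightarrow> repels E S f a b" using S_plain by blast
    then show ?thesis using g0 4 by (intro that[of f g0]) blast+
  qed
qed

lemma chi2_le_12_quadrangle: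
  assumes C: "C = {a, b, c, d}" and ne: "a \<noteq> c" "b \<noteq> d"
    and cyc: "cyc a b" "cyc b c" "cyc c d" "cyc d a"
  shows "chi2 V E \<le> 12"
proof -
  have cyc': "cyc b a" "cyc c b" "cyc d c" "cyc a d" using cyc cyc_sym by blast+
  have mem: "b \<in> C" "c \<in> C" using C by blast+
  \<comment> \<open>No chord ends at a balanced vertex, so with \<open>x\<close> and
    \<open>z\<close> balanced only the diagonal from \<open>y\<close> to \<open>w\<close> can be a
    chord.\<close>
  have diag: "cyc u v \<or> u = y \<or> v = y"
    if "C = {x, y, z, w}" "x \<in> bal" "z \<in> bal" "u \<in> C" "v \<in> C" "E u v" for u v x y z w
  proof (cases "u \<in> bal \<or> v \<in> bal")
    case True
    then show ?thesis using bal_edge_cyc' that by blast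
  next
    case False
    then have "u \<in> {y, w}" "v \<in> {y, w}" using that by blast+
    then show ?thesis using E_irrefl \<open>E u v\<close> by blast
  qed
  have C': "C = {b, c, d, a}" using C by blast
  have ac: "a \<in> bal \<and> c \<in> bal \<longrightarrow> (\<forall>u\<in>C. \<forall>v\<in>C. E u v \<longrightarrow> cyc u v \<or> u = b \<or> v = b)"
    using diag[OF C] by blast
  have bd: "b \<in> bal \<and> d \<in> bal \<longrightarrow> (\<forall>u\<in>C. \<forall>v\<in>C. E u v \<longrightarrow> cyc u v \<or> u = c \<or> v = c)"
    using diag[OF C'] by blast
  obtain f g where fg: "side_coloring V E C S lone_S f" "side_coloring V E C T lone_T g"
    "a \<in> bal \<and> c \<in> bal \<longrightarrow> repels E S f a c \<or> repels E T g a c"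
    "b \<in> bal \<and> d \<in> bal \<longrightarrow> repels E S f b d \<or> repels E T g b d"
    using colorings_across_diagonals[OF drawn_base base_reduction mem ne ac bd] by metis
  show ?thesis
  proof (rule chi2_le_12[OF fg(1,2)])
    fix u v assume uv: "u \<in> bal" "v \<in> bal" "u \<noteq> v"
    have "u \<in> {a, b, c, d}" "v \<in> {a, b, c, d}" using uv C by blast+
    then consider "cyc u v" | "{u, v} = {a, c}" | "{u, v} = {b, d}" using cyc cyc' uv(3) by blast
    then show "cyc u v \<or> repels E S f u v \<or> repels E T g u v"
    proof cases
      case 2
      then show ?thesis using fg(3) uv unfolding doubleton_eq_iff repels_def by metis
    next
      case 3
      then show ?thesis using fg(4) uv unfolding doubleton_eq_iff repels_def by metis
    qed blast
  qed
qed

text \<open>The pairs to separate avoid \<open>a\<close>: they are \<open>b e\<close>,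
  \<open>b d\<close> and \<open>c e\<close>. Smoothing at \<open>a\<close> creates the edge
  \<open>b e\<close> in the graph of \<open>S\<close>, which settles the first pair; the other two
  are the crossing diagonals of the quadrangle \<open>b c d e\<close>.\<close>

lemma chi2_le_12_pentagon_lone:
  assumes C: "C = {a, b, c, d, e}" and dist: "distinct [a, b, c, d, e]"
    and cyc: "cyc a b" "cyc b c" "cyc c d" "cyc d e" "cyc e a" and a: "a \<in> lone_S"
  shows "chi2 V E \<le> 12"
proof -
  have cyc': "cyc b a" "cyc c b" "cyc d c" "cyc e d" "cyc a e" using cyc cyc_sym by blast+
  define H where "H = add_edge cyc b e"
  have H: "H b c" "H c d" "H d e" "H e b" "H c b" "H d c" "H e d" "H b e"
    unfolding H_def add_edge_def using cyc cyc' by blast+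
  have ne: "b \<noteq> d" "c \<noteq> e" "b \<noteq> e" using dist by auto
  have mem: "c \<in> C" "d \<in> C" using C by blast+
  \<comment> \<open>The shortened cycle is a quadrangle, so \<open>c\<close> and \<open>d\<close>
    suffice as middle vertices.\<close>
  have diam: "\<forall>u\<in>C - {a}. \<forall>v\<in>C - {a}. u \<noteq> v \<longrightarrow> H u v \<or> (\<exists>w\<in>C - {a}. H u w \<and> H w v)"
  proof (intro ballI impI)
    fix u v assume that: "u \<in> C - {a}" "v \<in> C - {a}" "u \<noteq> v"
    have "u \<in> {b, c, d, e}" "v \<in> {b, c, d, e}" using that C by blast+
    then consider "H u v" | "H u c" "H c v" | "H u d" "H d v" using H that(3) by blast
    then show "H u v \<or> (\<exists>w\<in>C - {a}. H u w \<and> H w v)" using mem dist by cases auto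
  qed
  note sm = smoothing[OF a cyc'(1) cyc'(5) ne(3) diam[unfolded H_def]]
  obtain crv' where dr: "drawn {a} (add_edge (base {a}) b e) crv'" using sm(1) by blast
  \<comment> \<open>With \<open>b\<close> and \<open>d\<close> balanced, the possible chords are
    \<open>a c\<close> and \<open>c e\<close>, which share \<open>c\<close>.\<close>
  have xz: "cyc u v \<or> u = c \<or> v = c" if "b \<in> bal" "d \<in> bal" "u \<in> C" "v \<in> C" "E u v" for u v
  proof (cases "u \<in> bal \<or> v \<in> bal")
    case True
    then show ?thesis using bal_edge_cyc' that by blast
  next
    case False
    then have "u \<in> {a, c, e}" "v \<in> {a, c, e}" using that C by blast+
    then show ?thesis using E_irrefl \<open>E u v\<close> cyc(5) cyc'(5) by blast
  qed
  \<comment> \<open>With \<open>c\<close> and \<open>e\<close> balanced, the possible chords are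
    \<open>a d\<close> and \<open>b d\<close>, which share \<open>d\<close>.\<close>
  have yw: "cyc u v \<or> u = d \<or> v = d" if "c \<in> bal" "e \<in> bal" "u \<in> C" "v \<in> C" "E u v" for u v
  proof (cases "u \<in> bal \<or> v \<in> bal")
    case True
    then show ?thesis using bal_edge_cyc' that by blast
  next
    case False
    then have "u \<in> {a, b, d}" "v \<in> {a, b, d}" using that C by blast+
    then show ?thesis using E_irrefl \<open>E u v\<close> cyc(1) cyc'(1) by blast
  qed
  have bd: "b \<in> bal \<and> d \<in> bal \<longrightarrow> (\<forall>u\<in>C. \<forall>v\<in>C. E u v \<longrightarrow> cyc u v \<or> u = c \<or> v = c)"
    using xz by blast
  have ce: "c \<in> bal \<and> e \<in> bal \<longrightarrow> (\<forall>u\<in>C. \<forall>v\<in>C. E u v \<longrightarrow> cyc u v \<or> u = d \<or> v = d)"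
    using yw by blast
  obtain f g where fg: "side_coloring V E C S lone_S f" "side_coloring V E C T lone_T g"
    "\<forall>u\<in>C - {a}. \<forall>v\<in>C - {a}. add_edge (base {a}) b e u v \<longrightarrow> repels E S f u v"
    "b \<in> bal \<and> d \<in> bal \<longrightarrow> repels E S f b d \<or> repels E T g b d"
    "c \<in> bal \<and> e \<in> bal \<longrightarrow> repels E S f c e \<or> repels E T g c e"
  proof -
    show ?thesis by (rule colorings_across_diagonals[OF dr sm(2) mem ne(1,2) bd ce], rule that)
  qed
  have be: "repels E S f b e" using fg(3) C dist unfolding add_edge_def by auto
  show ?thesis
  proof (rule chi2_le_12[OF fg(1,2)])
    fix u v assume uv: "u \<in> bal" "v \<in> bal" "u \<noteq> v"
    have "u \<in> {b, c, d, e}" "v \<in> {b, c, d, e}" using uv C a by blast+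
    then consider "cyc u v" | "{u, v} = {b, d}" | "{u, v} = {c, e}" | "{u, v} = {b, e}"
      using cyc cyc' uv(3) by blast
    then show "cyc u v \<or> repels E S f u v \<or> repels E T g u v"
    proof cases
      case 2
      then show ?thesis using fg(4) uv unfolding doubleton_eq_iff repels_def by metis
    next
      case 3
      then show ?thesis using fg(5) uv unfolding doubleton_eq_iff repels_def by metis
    next
      case 4
      then show ?thesis using be unfolding doubleton_eq_iff repels_def by metis
    qed blast
  qed
qed

lemma chi2_le_12_pentagon:
  assumes "C = {a, b, c, d, e}" "distinct [a, b, c, d, e]"
    and "cyc a b" "cyc b c" "cyc c d" "cyc d e" "cyc e a" and "a \<notin> bal"
  shows "chi2 V E \<le> 12"
proof (cases "a \<in> lone_S")
  case True
  then show ?thesis using chi2_le_12_pentagon_lone assms by blast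
next
  case False
  then have "a \<in> lone_T" using assms by blast
  then show ?thesis using plane_cycle.chi2_le_12_pentagon_lone[OF swap] assms by blast
qed

end

subsection \<open>Short cycles of a plane graph\<close>

text \<open>Comparing unordered pairs makes the relation symmetric, as required of
  \<open>cyc\<close>, although the list traverses the cycle in one direction.\<close>

definition rim :: "'a list \<Rightarrow> 'a \<Rightarrow> 'a \<Rightarrow> bool" where
  "rim C u v \<longleftrightarrow> (\<exists>i<length C. {u, v} = {C ! i, C ! ((i + 1) mod length C)})"

lemma rim_explicit:
  "rim [a, b, c] u v \<longleftrightarrow> {u, v} \<in> {{a, b}, {b, c}, {c, a}}"
  "rim [a, b, c, d] u v \<longleftrightarrow> {u, v} \<in> {{a, b}, {b, c}, {c, d}, {d, a}}"
  "rim [a, b, c, d, e] u v \<longleftrightarrow> {u, v} \<in> {{a, b}, {b, c}, {c, d}, {d, e}, {e, a}}"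
proof -
  have ex: "(\<exists>i<3. P i) \<longleftrightarrow> P 0 \<or> P 1 \<or> P 2" "(\<exists>i<4. P i) \<longleftrightarrow> P 0 \<or> P 1 \<or> P 2 \<or> P 3"
    "(\<exists>i<5. P i) \<longleftrightarrow> P 0 \<or> P 1 \<or> P 2 \<or> P 3 \<or> P 4" for P :: "nat \<Rightarrow> bool"
    by (auto simp: numeral_eq_Suc less_Suc_eq)
  have len: "length [a, b, c] = 3" "length [a, b, c, d] = 4" "length [a, b, c, d, e] = 5" by simp_all
  show "rim [a, b, c] u v \<longleftrightarrow> {u, v} \<in> {{a, b}, {b, c}, {c, a}}"
    "rim [a, b, c, d] u v \<longleftrightarrow> {u, v} \<in> {{a, b}, {b, c}, {c, d}, {d, a}}"
    "rim [a, b, c, d, e] u v \<longleftrightarrow> {u, v} \<in> {{a, b}, {b, c}, {c, d}, {d, e}, {e, a}}"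
    unfolding rim_def len ex insert_iff empty_iff by simp_all
qed

text \<open>The Jordan curve theorem speaks of one simple closed path, whereas
  \<open>cycle_image\<close> is a union of edge curves; joining them in order turns the one into the
  other.\<close>

lemma cycle_image_eq_loop:
  assumes emb: "plane_embedding V E pos crv" and cyc: "is_cycle V E C"
  obtains \<gamma> where "simple_path \<gamma>" "pathfinish \<gamma> = pathstart \<gamma>" "path_image \<gamma> = cycle_image crv C"
proof -
  define n where "n = length C"
  have n: "n \<ge> 3" and dist: "distinct C"
    and edge: "\<And>i. i < n \<Longrightarrow> E (C ! i) (C ! ((i + 1) mod n))"
    using cyc unfolding is_cycle_def n_def by blast+
  define r where "r i = crv (C ! i) (C ! (i + 1))" for i
  have step: "E (C ! i) (C ! (i + 1))" if "i + 1 < n" for i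
    using edge[of i] that by simp
  have nth: "C ! i = C ! j \<longleftrightarrow> i = j" if "i < n" "j < n" for i j
    using nth_eq_iff_index_eq[OF dist] that n_def by blast
  \<comment> \<open>The induction stops at \<open>k < n\<close>: a proper part of the cycle is still
    an arc. The closing edge meets it at both ends and is attached by
    \<open>simple_path_join_loop\<close>.\<close>
  have arcs: "\<exists>g. arc g \<and> pathstart g = pos (C ! 0) \<and> pathfinish g = pos (C ! k) \<and>
      path_image g = (\<Union>i<k. path_image (r i))" if "1 \<le> k" "k < n" for k
    using that
  proof (induction k rule: nat_induct_at_least)
    case base
    then show ?case
      using plane_embeddingD(2-4)[OF emb step[of 0]] by (intro exI[of _ "r 0"]) (auto simp: r_def)
  next
    case (Suc k)
    then obtain g where g: "arc g" "pathstart g = pos (C ! 0)" "pathfinish g = pos (C ! k)"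
      "path_image g = (\<Union>i<k. path_image (r i))" by auto
    have Ek: "E (C ! k) (C ! (k + 1))" using step Suc.prems by simp
    note rk = plane_embeddingD(2-4)[OF emb Ek]
    have "path_image (r i) \<inter> path_image (r k) \<subseteq> {pos (C ! k)}" if i: "i < k" for i
    proof -
      have "{C ! i, C ! (i + 1)} \<noteq> {C ! k, C ! (k + 1)}"
        and sub: "{C ! i, C ! (i + 1)} \<inter> {C ! k, C ! (k + 1)} \<subseteq> {C ! k}"
        using i Suc.prems by (auto simp: nth doubleton_eq_iff)
      then have "path_image (r i) \<inter> path_image (r k) \<subseteq> pos ` ({C ! i, C ! (i + 1)} \<inter> {C ! k, C ! (k + 1)})"
        unfolding r_def using plane_embeddingD(7)[OF emb step Ek] i Suc.prems by simp
      also have "\<dots> \<subseteq> pos ` {C ! k}" using sub by (rule image_mono)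
      finally show ?thesis by simp
    qed
    then have "path_image g \<inter> path_image (r k) \<subseteq> {pos (C ! k)}" unfolding g(4) by blast
    then have "arc (g +++ r k)" using g rk unfolding r_def by (intro arc_join) simp_all
    moreover have "path_image (g +++ r k) = (\<Union>i<Suc k. path_image (r i))"
      using g rk by (simp add: path_image_join r_def lessThan_Suc Un_commute)
    ultimately show ?case using g rk by (intro exI[of _ "g +++ r k"]) (simp add: r_def)
  qed
  have "1 \<le> n - 1" "n - 1 < n" using n by simp_all
  then obtain g where g: "arc g" "pathstart g = pos (C ! 0)" "pathfinish g = pos (C ! (n - 1))"
      "path_image g = (\<Union>i<n - 1. path_image (r i))" using arcs by blast
  define l where "l = crv (C ! (n - 1)) (C ! 0)"
  have El: "E (C ! (n - 1)) (C ! 0)" using edge[of "n - 1"] n by simp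
  note l = plane_embeddingD(2-4)[OF emb El, folded l_def]
  have "path_image (r i) \<inter> path_image l \<subseteq> {pos (C ! 0), pos (C ! (n - 1))}" if i: "i < n - 1" for i
  proof -
    \<comment> \<open>This uses \<open>n \<ge> 3\<close>: with two vertices the closing edge would
      be the first edge again.\<close>
    have "{C ! i, C ! (i + 1)} \<noteq> {C ! (n - 1), C ! 0}"
    proof
      assume "{C ! i, C ! (i + 1)} = {C ! (n - 1), C ! 0}"
      then have "i = n - 1 \<or> i = 0 \<and> i + 1 = n - 1"
        using i n nth by (auto simp: doubleton_eq_iff)
      then show False using i n by auto
    qed
    then have "path_image (r i) \<inter> path_image l \<subseteq> pos ` ({C ! i, C ! (i + 1)} \<inter> {C ! (n - 1), C ! 0})"
      unfolding r_def l_def using plane_embeddingD(7)[OF emb step El] i by simp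
    also have "\<dots> \<subseteq> pos ` {C ! 0, C ! (n - 1)}" by (rule image_mono) blast
    finally show ?thesis by simp
  qed
  then have "path_image g \<inter> path_image l \<subseteq> {pos (C ! 0), pos (C ! (n - 1))}"
    unfolding g(4) by blast
  then have "simple_path (g +++ l)" using g l by (intro simple_path_join_loop) simp_all
  moreover have "path_image (g +++ l) = cycle_image crv C"
  proof -
    have n': "{..<n} = insert (n - 1) {..<n - 1}" using n by auto
    have "r i = crv (C ! i) (C ! ((i + 1) mod n))" if "i < n - 1" for i
      using that unfolding r_def by simp
    moreover have "l = crv (C ! (n - 1)) (C ! ((n - 1 + 1) mod n))" using n unfolding l_def by simp
    ultimately have "cycle_image crv C = path_image l \<union> (\<Union>i<n - 1. path_image (r i))"
      unfolding cycle_image_def n_def[symmetric] n' by simp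
    then show ?thesis using g l by (simp add: path_image_join Un_commute)
  qed
  ultimately show ?thesis using that[of "g +++ l"] g l by simp
qed

lemma rim_sym: "rim C u v \<Longrightarrow> rim C v u"
  unfolding rim_def by (simp add: insert_commute)

lemma rim_edge:
  assumes gr: "simple_graph V E" and cyc: "is_cycle V E C" and uv: "rim C u v"
  shows "E u v \<and> u \<in> set C \<and> v \<in> set C"
proof -
  obtain i where i: "i < length C" "{u, v} = {C ! i, C ! ((i + 1) mod length C)}"
    using uv unfolding rim_def by blast
  have E: "E (C ! i) (C ! ((i + 1) mod length C))" using cyc i(1) unfolding is_cycle_def by blast
  have "(i + 1) mod length C < length C" using i(1) by (intro mod_less_divisor) linarith
  then have "C ! i \<in> set C" "C ! ((i + 1) mod length C) \<in> set C" using i(1) by auto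
  then show ?thesis
    using E i(2) gr unfolding simple_graph_def doubleton_eq_iff by metis
qed

lemma cycle_image_rim:
  assumes gr: "simple_graph V E" and emb: "plane_embedding V E pos crv" and cyc: "is_cycle V E C"
  shows "cycle_image crv C = \<Union>{path_image (crv u v) |u v. rim C u v}"
proof
  show "cycle_image crv C \<subseteq> \<Union>{path_image (crv u v) |u v. rim C u v}"
    unfolding cycle_image_def rim_def by blast
  have "path_image (crv u v) \<subseteq> cycle_image crv C" if uv: "rim C u v" for u v
  proof -
    obtain i where i: "i < length C" "{u, v} = {C ! i, C ! ((i + 1) mod length C)}"
      using uv unfolding rim_def by blast
    have "E u v" using rim_edge[OF gr cyc uv] by blast
    then have "path_image (crv u v) = path_image (crv v u)" by (rule plane_embeddingD(5)[OF emb])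
    then have "path_image (crv u v) = path_image (crv (C ! i) (C ! ((i + 1) mod length C)))"
      using i(2) unfolding doubleton_eq_iff by metis
    then show ?thesis using i(1) unfolding cycle_image_def by blast
  qed
  then show "\<Union>{path_image (crv u v) |u v. rim C u v} \<subseteq> cycle_image crv C" by blast
qed

text \<open>Cycles of length at most 5 are exactly those of diameter at most 2, which is what makes
  every coloring of a side injective on the rim.\<close>

lemma rim_degree_diameter:
  assumes "distinct C" "3 \<le> length C" "length C \<le> 5"
  shows "c \<in> set C \<Longrightarrow> card {u. rim C c u} = 2"
    and "u \<in> set C \<Longrightarrow> v \<in> set C \<Longrightarrow> u \<noteq> v \<Longrightarrow> rim C u v \<or> (\<exists>w. rim C u w \<and> rim C w v)"
proof -
  have deg: "card {u. rim C c u} = 2"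
    if "{u. rim C c u} = {x, y}" "x \<noteq> y" for c x y using that by simp
  consider (3) a b d where "C = [a, b, d]" | (4) a b d e where "C = [a, b, d, e]"
    | (5) a b d e f where "C = [a, b, d, e, f]"
    using assms(2,3) by (auto simp: numeral_eq_Suc le_Suc_eq length_Suc_conv)
  note C_cases = this
  show "card {u. rim C c u} = 2" if c: "c \<in> set C"
    using C_cases
  proof cases
    case 3
    then have "{u. rim C a u} = {b, d}" "{u. rim C b u} = {a, d}" "{u. rim C d u} = {a, b}"
      using assms(1) by (auto simp: rim_explicit doubleton_eq_iff)
    then show ?thesis using c 3 assms(1) by auto
  next
    case 4
    then have "{u. rim C a u} = {b, e}" "{u. rim C b u} = {a, d}" "{u. rim C d u} = {b, e}"
      "{u. rim C e u} = {d, a}"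
      using assms(1) by (auto simp: rim_explicit doubleton_eq_iff)
    then show ?thesis using c 4 assms(1) by auto
  next
    case 5
    then have "{u. rim C a u} = {b, f}" "{u. rim C b u} = {a, d}" "{u. rim C d u} = {b, e}"
      "{u. rim C e u} = {d, f}" "{u. rim C f u} = {e, a}"
      using assms(1) by (auto simp: rim_explicit doubleton_eq_iff)
    then show ?thesis using c 5 assms(1) by auto
  qed
  show "rim C u v \<or> (\<exists>w. rim C u w \<and> rim C w v)" if uv: "u \<in> set C" "v \<in> set C" "u \<noteq> v"
    using C_cases
  proof cases
    case 3
    then have "rim C a b" "rim C b d" "rim C d a" by (simp_all add: rim_explicit)
    then have "rim C u v" using uv 3 rim_sym by auto
    then show ?thesis ..
  next
    case 4
    then have R: "rim C a b" "rim C b d" "rim C d e" "rim C e a" by (simp_all add: rim_explicit)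
    note R' = R[THEN rim_sym]
    have "u \<in> {a, b, d, e}" "v \<in> {a, b, d, e}" using uv 4 by simp_all
    then show ?thesis using R R' uv(3) by blast
  next
    case 5
    then have R: "rim C a b" "rim C b d" "rim C d e" "rim C e f" "rim C f a"
      by (simp_all add: rim_explicit)
    note R' = R[THEN rim_sym]
    have "u \<in> {a, b, d, e, f}" "v \<in> {a, b, d, e, f}" using uv 5 by simp_all
    then show ?thesis using R R' uv(3) by blast
  qed
qed

theorem theorem4:
  fixes V :: "'a set" and E :: "'a \<Rightarrow> 'a \<Rightarrow> bool"
    and pos :: "'a \<Rightarrow> complex" and crv :: "'a \<Rightarrow> 'a \<Rightarrow> real \<Rightarrow> complex"
  assumes G: "in_F V E" and chi: "chi2 V E > 12"
    and minimal: "\<And>(W :: 'a set) F. in_F W F \<Longrightarrow> chi2 W F > 12 \<Longrightarrow>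
        card V < card W \<or> (card V = card W \<and> card (edge_set V E) \<le> card (edge_set W F))"
    and emb: "plane_embedding V E pos crv"
  shows "\<not> (\<exists>C. length C \<le> 5 \<and> k_balanced 4 V E pos crv C)"
proof
  assume "\<exists>C. length C \<le> 5 \<and> k_balanced 4 V E pos crv C"
  then obtain C where len5: "length C \<le> 5" and kbal: "k_balanced 4 V E pos crv C" by blast
  have sep: "separating_cycle V E pos crv C"
    and few: "card {c \<in> set C. balanced_vertex V E pos crv C c} \<le> 4"
    using kbal unfolding k_balanced_def by blast+
  have cyc: "is_cycle V E C" using sep unfolding separating_cycle_def by blast
  have len3: "3 \<le> length C" and dist: "distinct C" and CV: "set C \<subseteq> V"
    using cyc unfolding is_cycle_def by blast+
  have gr: "simple_graph V E" and md: "max_degree_le V E 4" using G unfolding in_F_def by blast+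
  obtain \<gamma> where \<gamma>: "simple_path \<gamma>" "pathfinish \<gamma> = pathstart \<gamma>" "path_image \<gamma> = cycle_image crv C"
    using cycle_image_eq_loop[OF emb cyc] .
  let ?J = "cycle_image crv C"
  define S where "S = {v\<in>V. pos v \<in> inside ?J}"
  define T where "T = {v\<in>V. pos v \<in> outside ?J}"
  have J: "open (inside ?J)" "connected (inside ?J)" "open (outside ?J)" "connected (outside ?J)"
    "inside ?J \<inter> outside ?J = {}" "inside ?J \<union> outside ?J = - ?J"
    using Jordan_inside_outside[OF \<gamma>(1,2)] unfolding \<gamma>(3) by blast+
  interpret plane_cycle V E pos crv "rim C" "set C" ?J "inside ?J" "outside ?J" S T
  proof
    show "chi2 W F \<le> 12" if "in_F W F" "card W < card V" for W :: "'a set" and F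
      using minimal[OF that(1)] that(2) by linarith
    show "S \<noteq> {}" "T \<noteq> {}"
      using sep unfolding separating_cycle_def S_def T_def inside_cycle_def outside_cycle_def by blast+
    show "card (set C) \<le> 5" using len5 card_length[of C] by linarith
    show "rim C v u" if "rim C u v" for u v using that by (rule rim_sym)
    show "E u v \<and> u \<in> set C \<and> v \<in> set C" if "rim C u v" for u v by (rule rim_edge[OF gr cyc that])
    show "?J = \<Union>{path_image (crv u v) |u v. rim C u v}" by (rule cycle_image_rim[OF gr emb cyc])
    show "card {u. rim C c u} = 2" if "c \<in> set C" for c
      by (rule rim_degree_diameter(1)[OF dist len3 len5 that])
    show "rim C u v \<or> (\<exists>w. rim C u w \<and> rim C w v)" if "u \<in> set C" "v \<in> set C" "u \<noteq> v" for u v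
      by (rule rim_degree_diameter(2)[OF dist len3 len5 that])
  qed (fact gr md emb J S_def T_def CV)+
  have bal_balanced: "bal \<subseteq> {c \<in> set C. balanced_vertex V E pos crv C c}"
  proof
    fix c assume c: "c \<in> bal"
    then obtain x y where xy: "x \<in> S" "y \<in> T" "E c x" "E c y" unfolding lone_def by blast
    then have "x \<in> V - set C" "y \<in> V - set C" using V_cases disjoint by blast+
    moreover have "\<not> outside_cycle pos crv C x" "\<not> inside_cycle pos crv C y"
      using xy J(5) unfolding S_def T_def inside_cycle_def outside_cycle_def by blast+
    ultimately show "c \<in> {c \<in> set C. balanced_vertex V E pos crv C c}"
      using c xy unfolding balanced_vertex_def by blast
  qed
  consider (3) a b c where "C = [a, b, c]" | (4) a b c d where "C = [a, b, c, d]"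
    | (5) a b c d e where "C = [a, b, c, d, e]"
    using len3 len5 by (auto simp: numeral_eq_Suc le_Suc_eq length_Suc_conv)
  then have "chi2 V E \<le> 12"
  proof cases
    case 3
    then have "rim C a b" "rim C b c" "rim C c a" by (simp_all add: rim_explicit)
    then show ?thesis using 3 rim_sym by (intro chi2_le_12_triangle) auto
  next
    case 4
    then show ?thesis
      using dist by (intro chi2_le_12_quadrangle[of a b c d]) (auto simp: rim_explicit)
  next
    case 5
    \<comment> \<open>A 4-balanced pentagon has a vertex outside \<open>bal\<close>; the five
      rotations below bring it to the front, where \<open>chi2_le_12_pentagon\<close> expects
      it.\<close>
    have "card {c \<in> set C. balanced_vertex V E pos crv C c} < card (set C)"
      using few distinct_card[OF dist] 5 by simp
    then have "\<not> set C \<subseteq> bal"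
      using bal_balanced card_mono[of "{c \<in> set C. balanced_vertex V E pos crv C c}" "set C"]
      by fastforce
    moreover have R: "rim C a b" "rim C b c" "rim C c d" "rim C d e" "rim C e a"
      using 5 by (simp_all add: rim_explicit)
    moreover have "set C = {a, b, c, d, e}" "set C = {b, c, d, e, a}" "set C = {c, d, e, a, b}"
      "set C = {d, e, a, b, c}" "set C = {e, a, b, c, d}" using 5 by auto
    moreover have "distinct [a, b, c, d, e]" "distinct [b, c, d, e, a]" "distinct [c, d, e, a, b]"
      "distinct [d, e, a, b, c]" "distinct [e, a, b, c, d]" using dist 5 by auto
    moreover from \<open>\<not> set C \<subseteq> bal\<close> 5 consider "a \<notin> bal" | "b \<notin> bal" | "c \<notin> bal" | "d \<notin> bal" | "e \<notin> bal"
      by auto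
    ultimately show ?thesis using chi2_le_12_pentagon by metis
  qed
  then show False using chi by simp
qed

end
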